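(* Let $G$ be a finite or infinite connected graph with maximum valence 3. Suppose $G$ has a vertex $v$ of valence 2 of type 1. Then $D(G)\le 2$ or $G$ is isomorphic to $S_n$ for some $n\ge2$.
   Context: For a vertex $v$, let $\mathrm{Aut}_v(G)$ be the stabilizer of $v$ in the automorphism group; it induces a permutation group on the neighbors of $v$, and the type of $v$ is the order of this permutation group (so a valence 2 vertex has type 1 if every automorphism fixing $v$ fixes both neighbors, type 2 otherwise). $D(G)$ is the least number of colors in a vertex coloring of $G$ whose only color-preserving automorphism is the identity. For $n\ge1$, $T_n$ is the finite tree in which every vertex has valence 1 or 3 and every leaf has distance exactly $n$ from a fixed root; for $n\ge2$, $S_n$ is obtained from $T_n$ by joining by an edge every two leaves having a common neighbor. *)

theory Defs
  imports Main "HOL-Library.Extended_Nat" "HOL-Library.FuncSet" "HOL-Combinatorics.Permutations"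
begin

text \<open>A graph is a vertex set together with a symmetric irreflexive adjacency relation on it;
  both sets may be infinite.\<close>

definition simple_graph :: "'a set \<Rightarrow> ('a \<times> 'a) set \<Rightarrow> bool" where
  "simple_graph V E \<longleftrightarrow> E \<subseteq> V \<times> V \<and> sym E \<and> irrefl E"

definition connected_graph :: "'a set \<Rightarrow> ('a \<times> 'a) set \<Rightarrow> bool" where
  "connected_graph V E \<longleftrightarrow> V \<noteq> {} \<and> (\<forall>u\<in>V. \<forall>w\<in>V. (u, w) \<in> E\<^sup>*)"

definition neighbors :: "('a \<times> 'a) set \<Rightarrow> 'a \<Rightarrow> 'a set" where
  "neighbors E v = {w. (v, w) \<in> E}"

text \<open>Valences are extended natural numbers because \<^const>\<open>card\<close> is 0 on infinite sets, which
  would let vertices of infinite valence pass as isolated.\<close>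

definition valence :: "('a \<times> 'a) set \<Rightarrow> 'a \<Rightarrow> enat" where
  "valence E v = (if finite (neighbors E v) then enat (card (neighbors E v)) else \<infinity>)"

definition max_valence :: "'a set \<Rightarrow> ('a \<times> 'a) set \<Rightarrow> enat" where
  "max_valence V E = (SUP v\<in>V. valence E v)"

definition graph_iso :: "'a set \<Rightarrow> ('a \<times> 'a) set \<Rightarrow> 'b set \<Rightarrow> ('b \<times> 'b) set \<Rightarrow> bool" where
  "graph_iso V E V' E' \<longleftrightarrow>
     (\<exists>f. bij_betw f V V' \<and> (\<forall>x\<in>V. \<forall>y\<in>V. (f x, f y) \<in> E' \<longleftrightarrow> (x, y) \<in> E))"

text \<open>Automorphisms fix everything outside the vertex set, so that two of them are equal as
  functions exactly if they agree on the vertices.\<close>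

definition Aut :: "'a set \<Rightarrow> ('a \<times> 'a) set \<Rightarrow> ('a \<Rightarrow> 'a) set" where
  "Aut V E = {\<phi>. \<phi> permutes V \<and> (\<forall>x\<in>V. \<forall>y\<in>V. (\<phi> x, \<phi> y) \<in> E \<longleftrightarrow> (x, y) \<in> E)}"

definition Aut_stab :: "'a set \<Rightarrow> ('a \<times> 'a) set \<Rightarrow> 'a \<Rightarrow> ('a \<Rightarrow> 'a) set" where
  "Aut_stab V E v = {\<phi> \<in> Aut V E. \<phi> v = v}"

definition vertex_type :: "'a set \<Rightarrow> ('a \<times> 'a) set \<Rightarrow> 'a \<Rightarrow> nat" where
  "vertex_type V E v = card ((\<lambda>\<phi>. restrict \<phi> (neighbors E v)) ` Aut_stab V E v)"

definition distinguishing :: "'a set \<Rightarrow> ('a \<times> 'a) set \<Rightarrow> ('a \<Rightarrow> nat) \<Rightarrow> bool" where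
  "distinguishing V E c \<longleftrightarrow> (\<forall>\<phi>\<in>Aut V E. (\<forall>x\<in>V. c (\<phi> x) = c x) \<longrightarrow> \<phi> = id)"

text \<open>The value is \<open>\<infinity>\<close> (the infimum of the empty set) if no finite number of colors suffices.\<close>

definition distinguishing_number :: "'a set \<Rightarrow> ('a \<times> 'a) set \<Rightarrow> enat" where
  "distinguishing_number V E = Inf {enat k |k. \<exists>c \<in> V \<rightarrow> {..<k}. distinguishing V E c}"

definition graph_dist :: "('a \<times> 'a) set \<Rightarrow> 'a \<Rightarrow> 'a \<Rightarrow> nat" where
  "graph_dist E u w = (LEAST n. (u, w) \<in> E ^^ n)"

definition graph_cycle :: "('a \<times> 'a) set \<Rightarrow> 'a list \<Rightarrow> bool" where
  "graph_cycle E xs \<longleftrightarrow> length xs \<ge> 3 \<and> distinct xs \<and>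
     (\<forall>i<length xs. (xs ! i, xs ! (Suc i mod length xs)) \<in> E)"

definition tree :: "'a set \<Rightarrow> ('a \<times> 'a) set \<Rightarrow> bool" where
  "tree V E \<longleftrightarrow> simple_graph V E \<and> connected_graph V E \<and> \<not> (\<exists>xs. graph_cycle E xs)"

definition leaves :: "'a set \<Rightarrow> ('a \<times> 'a) set \<Rightarrow> 'a set" where
  "leaves V E = {x \<in> V. valence E x = 1}"

text \<open>\<open>is_T n V E\<close> and \<open>is_S n V E\<close> say that \<open>(V, E)\<close> is a copy of \<open>T\<^sub>n\<close> and \<open>S\<^sub>n\<close>.\<close>

definition is_T :: "nat \<Rightarrow> 'a set \<Rightarrow> ('a \<times> 'a) set \<Rightarrow> bool" where
  "is_T n V E \<longleftrightarrow> finite V \<and> tree V E \<and> (\<forall>x\<in>V. valence E x = 1 \<or> valence E x = 3) \<and>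
     (\<exists>r\<in>V. \<forall>x\<in>leaves V E. graph_dist E r x = n)"

definition join_twin_leaves :: "'a set \<Rightarrow> ('a \<times> 'a) set \<Rightarrow> ('a \<times> 'a) set" where
  "join_twin_leaves V E = E \<union> {(x, y). x \<in> leaves V E \<and> y \<in> leaves V E \<and> x \<noteq> y \<and>
     neighbors E x \<inter> neighbors E y \<noteq> {}}"

definition is_S :: "nat \<Rightarrow> 'a set \<Rightarrow> ('a \<times> 'a) set \<Rightarrow> bool" where
  "is_S n V E \<longleftrightarrow> (\<exists>E\<^sub>T. is_T n V E\<^sub>T \<and> E = join_twin_leaves V E\<^sub>T)"

end

(* Write N for neighbourhoods and O for orbits of Aut(G). If v and some neighbours of v are fixed, the
   colouring is extended outwards: a vertex that is determined by the vertices already fixed becomes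
   white, and two vertices that can still be exchanged get different colours. So fixing v leaves
   only one task, to make v recognizable. In general, colour v and its two neighbours black; among two
   exchangeable vertices, the black one can be chosen such that no other vertex of O(v) is black with
   only black neighbours. This fails in two situations. If N(v') = N(v) for some v' other than v, the
   pair of neighbours of v is made the only black pair in its orbit. If v is in a triangle with
   a twin of valence 2, the chain r_0 = v, r_1, r_2, ... climbs as long as two of the three
   neighbours of r_(i+1) are in O(r_i), the third being r_(i+2). Where it stops, at s = r_(k+1), either the
   arc (r_k, s) is recognizable by its two black ends, or every vertex climbs to s (or to the edge r_k s).
   In the latter case, and if the chain never stops, colouring r_i black and its sibling white works,
   unless s has three neighbours in O(r_k), and then G is a copy of S_(k+1). *)
theory Submission
  imports Defs
begin

text \<open>A fixed vertex with a fixed neighbour has at most two further neighbours, so the only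
  ambiguity ever met outwards is one between two vertices with the same fixed neighbours. White
  vertices never copy the pattern that marks \<open>v\<close>; hence a choice fails only if
  blackening either vertex of every such pair completes a copy, and this is what the hypotheses of
  each case refute. Type 1 says that fixing \<open>v\<close> also fixes its two neighbours, and that
  these cannot be swapped as twins. In the triangle, \<open>v\<close> and its twin share all other
  neighbours, so no pattern nearby can single out \<open>v\<close>, and the search moves up the
  tree. A binary tree of the kind hanging there has, up to symmetry, just two distinguishing
  2-colourings, one for each colour of its root: the two subtrees below a vertex must carry the two
  different ones. Hence two equivalent trees can be told apart with two colours, also when they are
  joined at the roots by a reversible edge, but three below a common vertex cannot. This is why
  \<open>S_n\<close> is the exception.\<close>

definition orbit :: "'a set \<Rightarrow> ('a \<times> 'a) set \<Rightarrow> 'a \<Rightarrow> 'a set" where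
  "orbit V E x = (\<lambda>\<phi>. \<phi> x) ` Aut V E"

definition two_distinguishable :: "'a set \<Rightarrow> ('a \<times> 'a) set \<Rightarrow> bool" where
  "two_distinguishable V E \<longleftrightarrow>
     (\<exists>B. \<forall>\<phi>\<in>Aut V E. (\<forall>x\<in>V. \<phi> x \<in> B \<longleftrightarrow> x \<in> B) \<longrightarrow> \<phi> = id)"

lemma distinguishing_number_le_2:
  assumes "two_distinguishable V E"
  shows "distinguishing_number V E \<le> 2"
proof -
  obtain B where B: "\<And>\<phi>. \<phi> \<in> Aut V E \<Longrightarrow> (\<forall>x\<in>V. \<phi> x \<in> B \<longleftrightarrow> x \<in> B) \<Longrightarrow> \<phi> = id"
    using assms unfolding two_distinguishable_def by blast
  let ?c = "\<lambda>x. if x \<in> B then 1 else 0 :: nat"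
  have "distinguishing V E ?c"
    unfolding distinguishing_def
  proof (intro ballI impI)
    fix \<phi> assume \<phi>: "\<phi> \<in> Aut V E" and c: "\<forall>x\<in>V. ?c (\<phi> x) = ?c x"
    have "\<forall>x\<in>V. \<phi> x \<in> B \<longleftrightarrow> x \<in> B"
      using c by (metis zero_neq_one)
    then show "\<phi> = id" using B \<phi> by blast
  qed
  moreover have "?c \<in> V \<rightarrow> {..<2}" by auto
  ultimately have "enat 2 \<in> {enat k |k. \<exists>c \<in> V \<rightarrow> {..<k}. distinguishing V E c}" by blast
  then have "distinguishing_number V E \<le> enat 2"
    unfolding distinguishing_number_def by (rule Inf_lower)
  then show ?thesis by (simp add: numeral_eq_enat)
qed

lemma neighbors_iff [simp]: "y \<in> neighbors E x \<longleftrightarrow> (x, y) \<in> E"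
  by (simp add: neighbors_def)

section \<open>Automorphisms and orbits of connected graphs of valence at most 3\<close>

locale subcubic_graph =
  fixes V :: "'a set" and E :: "('a \<times> 'a) set"
  assumes simple: "simple_graph V E"
    and connected: "connected_graph V E"
    and finite_neighbors: "x \<in> V \<Longrightarrow> finite (neighbors E x)"
    and card_neighbors_le: "x \<in> V \<Longrightarrow> card (neighbors E x) \<le> 3"
begin

abbreviation N :: "'a \<Rightarrow> 'a set" where "N \<equiv> neighbors E"
abbreviation Orb :: "'a \<Rightarrow> 'a set" where "Orb \<equiv> orbit V E"

lemma edge_in: "(x, y) \<in> E \<Longrightarrow> x \<in> V" "(x, y) \<in> E \<Longrightarrow> y \<in> V"
  using simple by (auto simp: simple_graph_def)

lemma edge_sym: "(x, y) \<in> E \<longleftrightarrow> (y, x) \<in> E"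
  using simple by (auto simp: simple_graph_def dest: symD)

lemma edge_irrefl [simp]: "(x, x) \<notin> E"
  using simple by (auto simp: simple_graph_def dest: irreflD)

lemma edge_neq: "(x, y) \<in> E \<Longrightarrow> x \<noteq> y"
  by auto

text \<open>Paths that start in \<open>W\<close> stay there; this replaces induction on
  distances.\<close>

lemma connected_closed:
  assumes "W \<subseteq> V" "W \<noteq> {}" and closed: "\<And>x y. x \<in> W \<Longrightarrow> (x, y) \<in> E \<Longrightarrow> y \<in> W"
  shows "W = V"
proof -
  obtain u where u: "u \<in> W" using assms by blast
  have "w \<in> W" if "w \<in> V" for w
  proof -
    have "(u, w) \<in> E\<^sup>*"
      using connected u that assms(1) by (auto simp: connected_graph_def)
    then show ?thesis
      by (induction rule: rtrancl_induct) (use u closed in auto)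
  qed
  then show ?thesis using assms(1) by auto
qed

lemma Aut_id: "id \<in> Aut V E"
  by (auto simp: Aut_def permutes_id)

lemma Aut_comp: "\<phi> \<in> Aut V E \<Longrightarrow> \<psi> \<in> Aut V E \<Longrightarrow> \<phi> \<circ> \<psi> \<in> Aut V E"
  by (simp add: Aut_def permutes_compose permutes_in_image)

lemma Aut_in: "\<phi> \<in> Aut V E \<Longrightarrow> \<phi> x \<in> V \<longleftrightarrow> x \<in> V"
  by (auto simp: Aut_def permutes_in_image)

text \<open>Outside \<open>V\<close> both sides are false, because edges have their ends in
  \<open>V\<close> and \<phi> preserves \<open>V\<close>.\<close>

lemma Aut_edge: "\<phi> \<in> Aut V E \<Longrightarrow> (\<phi> x, \<phi> y) \<in> E \<longleftrightarrow> (x, y) \<in> E"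
  unfolding Aut_def mem_Collect_eq using edge_in by (meson permutes_in_image)

lemma Aut_inv_eq: "\<phi> \<in> Aut V E \<Longrightarrow> \<phi> (inv \<phi> x) = x" "\<phi> \<in> Aut V E \<Longrightarrow> inv \<phi> (\<phi> x) = x"
  by (auto simp: Aut_def permutes_inverses)

lemma Aut_eq_iff: "\<phi> \<in> Aut V E \<Longrightarrow> \<phi> x = \<phi> y \<longleftrightarrow> x = y"
  by (metis Aut_inv_eq(2))

lemma Aut_inv: "\<phi> \<in> Aut V E \<Longrightarrow> inv \<phi> \<in> Aut V E"
proof -
  assume \<phi>: "\<phi> \<in> Aut V E"
  have "(inv \<phi> x, inv \<phi> y) \<in> E \<longleftrightarrow> (x, y) \<in> E" for x y
    using Aut_edge[OF \<phi>, of "inv \<phi> x" "inv \<phi> y"] by (simp add: Aut_inv_eq(1)[OF \<phi>])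
  then show ?thesis using \<phi> by (simp add: Aut_def permutes_inv)
qed

lemma Aut_neighbors: "\<phi> \<in> Aut V E \<Longrightarrow> N (\<phi> x) = \<phi> ` N x"
proof -
  assume \<phi>: "\<phi> \<in> Aut V E"
  have "y \<in> \<phi> ` N x" if "(\<phi> x, y) \<in> E" for y
    using Aut_edge[OF \<phi>, of x "inv \<phi> y"] Aut_inv_eq(1)[OF \<phi>, of y] that
    by (intro image_eqI[of _ _ "inv \<phi> y"]) auto
  then show ?thesis using Aut_edge[OF \<phi>] by auto
qed

lemma Orb_self: "x \<in> Orb x"
  unfolding orbit_def using Aut_id by (metis id_apply image_eqI)

lemma Orb_I: "\<phi> \<in> Aut V E \<Longrightarrow> \<phi> x \<in> Orb x"
  unfolding orbit_def by blast

lemma Orb_image_iff: "\<phi> \<in> Aut V E \<Longrightarrow> \<phi> y \<in> Orb x \<longleftrightarrow> y \<in> Orb x"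
proof -
  assume \<phi>: "\<phi> \<in> Aut V E"
  have "\<phi> y \<in> Orb x" if "y \<in> Orb x" "\<phi> \<in> Aut V E" for \<phi> y
    using that Aut_comp[of \<phi>] Orb_I[of "\<phi> \<circ> _" x] by (auto simp: orbit_def)
  from this[OF _ \<phi>] this[OF _ Aut_inv[OF \<phi>], of "\<phi> y"] show ?thesis
    by (auto simp: Aut_inv_eq(2)[OF \<phi>])
qed

lemma Orb_eq: "y \<in> Orb x \<Longrightarrow> Orb y = Orb x"
proof -
  assume "y \<in> Orb x"
  then obtain \<phi> where \<phi>: "\<phi> \<in> Aut V E" "y = \<phi> x" unfolding orbit_def by blast
  have "z \<in> Orb y \<longleftrightarrow> z \<in> Orb x" for z
  proof
    assume "z \<in> Orb y"
    then obtain \<psi> where "\<psi> \<in> Aut V E" "z = \<psi> y" unfolding orbit_def by blast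
    then show "z \<in> Orb x" using \<phi> Orb_image_iff \<open>y \<in> Orb x\<close> by blast
  next
    assume "z \<in> Orb x"
    then obtain \<psi> where "\<psi> \<in> Aut V E" "z = \<psi> x" unfolding orbit_def by blast
    then show "z \<in> Orb y"
      using \<phi> Orb_image_iff[of \<psi> x y] Orb_I[OF Aut_inv[OF \<phi>(1)], of y] Aut_inv_eq(2)
      by fastforce
  qed
  then show ?thesis by blast
qed

lemma Orb_subset: "x \<in> V \<Longrightarrow> Orb x \<subseteq> V"
  unfolding orbit_def using Aut_in by auto

lemma Aut_neighbors_Orb: "\<phi> \<in> Aut V E \<Longrightarrow> N (\<phi> x) \<inter> Orb y = \<phi> ` (N x \<inter> Orb y)"
  by (auto simp: Aut_neighbors Orb_image_iff)

lemma Orb_obtain: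
  assumes "y \<in> Orb x"
  obtains \<psi> where "\<psi> \<in> Aut V E" "y = \<psi> x"
  using assms unfolding orbit_def by blast

lemma card_neighbors_Orb:
  assumes "y \<in> Orb x"
  shows "card (N y) = card (N x)" "card (N y \<inter> Orb z) = card (N x \<inter> Orb z)"
proof -
  obtain \<psi> where \<psi>: "\<psi> \<in> Aut V E" "y = \<psi> x" using Orb_obtain[OF assms] .
  have inj: "inj_on \<psi> X" for X using Aut_eq_iff[OF \<psi>(1)] by (simp add: inj_on_def)
  show "card (N y) = card (N x)"
    using Aut_neighbors[OF \<psi>(1), of x] card_image[OF inj] \<psi>(2) by simp
  show "card (N y \<inter> Orb z) = card (N x \<inter> Orb z)"
    using Aut_neighbors_Orb[OF \<psi>(1), of x z] card_image[OF inj] \<psi>(2) by simp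
qed

lemma Aut_neighbors_obtain:
  assumes "\<psi> \<in> Aut V E" "(\<psi> x, y) \<in> E"
  obtains y0 where "y0 \<in> N x" "y = \<psi> y0"
proof -
  have "y \<in> N (\<psi> x)" using assms(2) by simp
  then show ?thesis using that unfolding Aut_neighbors[OF assms(1)] by blast
qed

lemma Orb_eqI: "z \<in> Orb x \<Longrightarrow> z \<in> Orb y \<Longrightarrow> Orb x = Orb y"
  using Orb_eq by metis

text \<open>Source of the nontrivial automorphisms that the proof constructs. Removing the other
  vertex from each side treats adjacent and non-adjacent twins alike.\<close>

lemma Aut_transpose:
  assumes "x \<in> V" "y \<in> V" and tw: "N x - {y} = N y - {x}"
  shows "transpose x y \<in> Aut V E"
proof -
  have eq: "(x, z) \<in> E \<longleftrightarrow> (y, z) \<in> E" if "z \<noteq> x" "z \<noteq> y" for z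
    using tw that unfolding set_eq_iff by (metis Diff_iff neighbors_iff singletonD)
  then have eq': "(z, x) \<in> E \<longleftrightarrow> (z, y) \<in> E" if "z \<noteq> x" "z \<noteq> y" for z
    using that by (metis edge_sym)
  have "(transpose x y u, transpose x y w) \<in> E \<longleftrightarrow> (u, w) \<in> E" for u w
    using eq[of u] eq[of w] eq'[of u] eq'[of w] edge_sym[of x y]
    unfolding transpose_def by (smt (verit) edge_irrefl)
  then show ?thesis
    using assms by (auto simp: Aut_def permutes_swap_id)
qed

section \<open>Greedy colourings\<close>

text \<open>Only neighbours inside \<open>F\<close> are compared. The two vertices need not be
  exchanged by any automorphism; colouring them differently is safe in either case.\<close>

definition twin :: "'a set \<Rightarrow> 'a \<Rightarrow> 'a \<Rightarrow> 'a \<Rightarrow> bool" where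
  "twin F p w w' \<longleftrightarrow> p \<in> F \<and> w \<noteq> w' \<and> N p - F = {w, w'} \<and> N w \<inter> F = N w' \<inter> F"

text \<open>The recurring contradiction with this property is a vertex of \<open>F\<close> with
  exactly one neighbour outside \<open>F\<close>.\<close>

definition stalled :: "'a set \<Rightarrow> bool" where
  "stalled F \<longleftrightarrow> (\<forall>p\<in>F. N p - F = {} \<or> (\<exists>w w'. twin F p w w'))"

lemma twin_sym: "twin F p w w' \<Longrightarrow> twin F p w' w"
  by (auto simp: twin_def)

text \<open>Quantifying over all black sets that agree with \<open>S\<close> makes the property
  independent of the colours given later. In the applications \<open>H\<close> is the stabilizer of
  the starting vertex.\<close>

definition fixing :: "('a \<Rightarrow> 'a) set \<Rightarrow> ('a \<times> bool) set \<Rightarrow> bool" where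
  "fixing H S \<longleftrightarrow> (\<forall>B. (\<forall>(x, b)\<in>S. (x \<in> B) = b) \<longrightarrow>
     (\<forall>\<phi>\<in>H. (\<forall>x\<in>V. \<phi> x \<in> B \<longleftrightarrow> x \<in> B) \<longrightarrow> (\<forall>x\<in>Domain S. \<phi> x = x)))"

lemma fixingD:
  assumes "fixing H S" "\<And>x b. (x, b) \<in> S \<Longrightarrow> (x \<in> B) = b" "\<phi> \<in> H"
    "\<And>x. x \<in> V \<Longrightarrow> \<phi> x \<in> B \<longleftrightarrow> x \<in> B" "x \<in> Domain S"
  shows "\<phi> x = x"
proof -
  have "\<forall>(x, b)\<in>S. (x \<in> B) = b" "\<forall>x\<in>V. \<phi> x \<in> B \<longleftrightarrow> x \<in> B"
    using assms by auto
  with assms(1) have "\<forall>\<phi>\<in>H. (\<forall>x\<in>V. \<phi> x \<in> B \<longleftrightarrow> x \<in> B) \<longrightarrow> (\<forall>x\<in>Domain S. \<phi> x = x)"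
    unfolding fixing_def by simp
  with assms(3,5) \<open>\<forall>x\<in>V. \<phi> x \<in> B \<longleftrightarrow> x \<in> B\<close> show ?thesis by simp
qed

lemma fixingI:
  assumes "\<And>B \<phi> x. (\<And>x b. (x, b) \<in> S \<Longrightarrow> (x \<in> B) = b) \<Longrightarrow> \<phi> \<in> H \<Longrightarrow>
    (\<And>x. x \<in> V \<Longrightarrow> \<phi> x \<in> B \<longleftrightarrow> x \<in> B) \<Longrightarrow> x \<in> Domain S \<Longrightarrow> \<phi> x = x"
  shows "fixing H S"
  unfolding fixing_def
proof (intro allI impI ballI)
  fix B \<phi> x
  assume "\<forall>(x, b)\<in>S. (x \<in> B) = b" "\<phi> \<in> H" "\<forall>x\<in>V. (\<phi> x \<in> B) = (x \<in> B)" "x \<in> Domain S"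
  then show "\<phi> x = x" by (intro assms[of B]) auto
qed

text \<open>Partial colourings are relations, so that the limit of a chain is its union. The
  condition on neighbours leaves at most two uncoloured neighbours at each coloured vertex.\<close>

definition admissible ::
  "('a \<Rightarrow> 'a) set \<Rightarrow> 'a set set \<Rightarrow> ('a \<times> bool) set \<Rightarrow> ('a \<times> bool) set \<Rightarrow> bool" where
  "admissible H \<B> S0 S \<longleftrightarrow> S0 \<subseteq> S \<and> single_valued S \<and> Domain S \<subseteq> V \<and>
     (\<forall>x\<in>Domain S. N x \<inter> Domain S \<noteq> {}) \<and> (\<forall>X\<in>\<B>. \<not> X \<times> {True} \<subseteq> S) \<and> fixing H S"

text \<open>A finite black set inside the union already lies in one member of the chain; here the
  finiteness of the forbidden sets is used.\<close>

lemma admissible_Union: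
  assumes chain: "subset.chain {S. admissible H \<B> S0 S} \<C>" and "\<C> \<noteq> {}"
    and fin: "\<And>X. X \<in> \<B> \<Longrightarrow> finite X"
  shows "admissible H \<B> S0 (\<Union>\<C>)"
proof -
  have ad: "admissible H \<B> S0 S" if "S \<in> \<C>" for S
    using chain that by (auto simp: subset.chain_def)
  have dir: "S \<subseteq> T \<or> T \<subseteq> S" if "S \<in> \<C>" "T \<in> \<C>" for S T
    using chain that by (auto simp: subset.chain_def)
  have "single_valued (\<Union>\<C>)"
  proof (rule single_valuedI)
    fix x y z assume "(x, y) \<in> \<Union>\<C>" "(x, z) \<in> \<Union>\<C>"
    then obtain S T where "S \<in> \<C>" "T \<in> \<C>" "(x, y) \<in> S" "(x, z) \<in> T" by blast
    then have "\<exists>R\<in>\<C>. (x, y) \<in> R \<and> (x, z) \<in> R" using dir by blast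
    then show "y = z" using ad unfolding admissible_def by (metis single_valuedD)
  qed
  moreover have "S0 \<subseteq> \<Union>\<C>" using ad \<open>\<C> \<noteq> {}\<close> unfolding admissible_def by blast
  moreover have "Domain (\<Union>\<C>) \<subseteq> V" using ad unfolding admissible_def by (auto simp: Domain_iff) blast
  moreover have "N x \<inter> Domain (\<Union>\<C>) \<noteq> {}" if x: "x \<in> Domain (\<Union>\<C>)" for x
  proof -
    obtain S where S: "S \<in> \<C>" "x \<in> Domain S" using x by (auto simp: Domain_iff)
    then have "N x \<inter> Domain S \<noteq> {}" using ad[OF S(1)] unfolding admissible_def by blast
    moreover have "Domain S \<subseteq> Domain (\<Union>\<C>)" using S(1) by (auto simp: Domain_iff)
    ultimately show ?thesis by blast
  qed
  moreover have "\<not> X \<times> {True} \<subseteq> \<Union>\<C>" if X: "X \<in> \<B>" for X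
  proof
    assume "X \<times> {True} \<subseteq> \<Union>\<C>"
    moreover have "finite (X \<times> {True})" using fin X by blast
    ultimately obtain S where "S \<in> \<C>" "X \<times> {True} \<subseteq> S"
      using finite_subset_Union_chain[OF _ _ \<open>\<C> \<noteq> {}\<close> chain] by blast
    then show False using ad that unfolding admissible_def by blast
  qed
  moreover have "fixing H (\<Union>\<C>)"
  proof (rule fixingI)
    fix B \<phi> x
    assume B: "\<And>x b. (x, b) \<in> \<Union>\<C> \<Longrightarrow> (x \<in> B) = b" and \<phi>: "\<phi> \<in> H"
      and pres: "\<And>x. x \<in> V \<Longrightarrow> \<phi> x \<in> B \<longleftrightarrow> x \<in> B" and x: "x \<in> Domain (\<Union>\<C>)"
    obtain S where S: "S \<in> \<C>" "x \<in> Domain S" using x by (auto simp: Domain_iff)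
    then have "fixing H S" using ad unfolding admissible_def by blast
    then show "\<phi> x = x" by (rule fixingD[where B = B]) (use B \<phi> pres S in auto)
  qed
  ultimately show ?thesis unfolding admissible_def by (intro conjI ballI)
qed

text \<open>Common to both ways of extending: by one white vertex, or by a black and a white
  one.\<close>

lemma admissible_extend:
  assumes S: "admissible H \<B> S0 S" and H: "H \<subseteq> Aut V E"
    and T: "single_valued T" "T \<noteq> {}" "Domain T \<inter> Domain S = {}"
      "\<And>x. x \<in> Domain T \<Longrightarrow> \<exists>p\<in>Domain S. (p, x) \<in> E"
    and avoid: "\<And>X. X \<in> \<B> \<Longrightarrow> \<not> X \<times> {True} \<subseteq> S \<union> T"
    and fix_T: "\<And>\<phi> x B. \<phi> \<in> H \<Longrightarrow> \<forall>y\<in>Domain S. \<phi> y = y \<Longrightarrow> x \<in> Domain T \<Longrightarrow>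
      \<forall>y\<in>V. \<phi> y \<in> B \<longleftrightarrow> y \<in> B \<Longrightarrow> \<forall>(y, b)\<in>T. (y \<in> B) = b \<Longrightarrow> \<phi> x = x"
  shows "admissible H \<B> S0 (S \<union> T)" "S \<union> T \<noteq> S"
proof -
  have svS: "single_valued S" and domS: "Domain S \<subseteq> V"
    and nS: "\<And>x. x \<in> Domain S \<Longrightarrow> N x \<inter> Domain S \<noteq> {}"
    and fS: "fixing H S" and "S0 \<subseteq> S"
    using S by (simp_all add: admissible_def)
  have "single_valued (S \<union> T)"
  proof (rule single_valuedI)
    fix x y z assume "(x, y) \<in> S \<union> T" "(x, z) \<in> S \<union> T"
    then show "y = z"
      using T(3) single_valuedD[OF svS] single_valuedD[OF T(1)]
      by (metis Un_iff Domain.DomainI disjoint_iff)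
  qed
  moreover have "Domain (S \<union> T) \<subseteq> V"
    using domS T(4)[THEN bexE, of _ "_ \<in> V"] edge_in(2) unfolding Domain_Un_eq by (meson Un_least subsetI)
  moreover have "N x \<inter> Domain (S \<union> T) \<noteq> {}" if x: "x \<in> Domain (S \<union> T)" for x
  proof (cases "x \<in> Domain S")
    case True
    then show ?thesis using nS by (auto simp: Domain_Un_eq)
  next
    case False
    then obtain p where "p \<in> Domain S" "(p, x) \<in> E" using T(4) x by blast
    then have "p \<in> N x \<inter> Domain (S \<union> T)" using edge_sym by auto
    then show ?thesis by blast
  qed
  moreover have "fixing H (S \<union> T)"
  proof (rule fixingI)
    fix B \<phi> x
    assume B: "\<And>x b. (x, b) \<in> S \<union> T \<Longrightarrow> (x \<in> B) = b" and \<phi>: "\<phi> \<in> H"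
      and pres: "\<And>x. x \<in> V \<Longrightarrow> \<phi> x \<in> B \<longleftrightarrow> x \<in> B" and x: "x \<in> Domain (S \<union> T)"
    have fixS: "\<phi> y = y" if "y \<in> Domain S" for y
      using fS by (rule fixingD[where B = B]) (use B \<phi> pres that in auto)
    show "\<phi> x = x"
    proof (cases "x \<in> Domain S")
      case True then show ?thesis using fixS by blast
    next
      case False
      then have xT: "x \<in> Domain T" using x by blast
      show ?thesis
        by (rule fix_T[OF \<phi> _ xT, of B]) (use B fixS pres in auto)
    qed
  qed
  moreover have "S0 \<subseteq> S \<union> T" using \<open>S0 \<subseteq> S\<close> by blast
  ultimately show "admissible H \<B> S0 (S \<union> T)"
    using avoid unfolding admissible_def by (intro conjI ballI)
  obtain x b where xb: "(x, b) \<in> T" using T(2) by auto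
  then have "(x, b) \<notin> S" using T(3) by (metis Domain.DomainI disjoint_iff)
  then show "S \<union> T \<noteq> S" using xb by blast
qed

text \<open>A vertex of \<open>F\<close> has at most two neighbours outside \<open>F\<close>. A
  single one is fixed along with \<open>F\<close>. If there are two and they are not twins, some
  \<open>q\<close> in \<open>F\<close> is adjacent to exactly one of them, and that one is
  fixed.\<close>

lemma not_stalled_obtains:
  assumes F: "F \<subseteq> V" "\<forall>x\<in>F. N x \<inter> F \<noteq> {}" and ns: "\<not> stalled F"
  obtains p w where "p \<in> F" "w \<in> N p - F"
    "\<And>\<phi>. \<phi> \<in> Aut V E \<Longrightarrow> \<forall>y\<in>F. \<phi> y = y \<Longrightarrow> \<phi> w = w"
proof -
  obtain p where p: "p \<in> F" "N p - F \<noteq> {}" "\<And>w w'. \<not> twin F p w w'"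
    using ns unfolding stalled_def by blast
  have finN: "finite (N p)" and cN: "card (N p) \<le> 3"
    using p(1) F(1) finite_neighbors card_neighbors_le by auto
  have "card (N p \<inter> F) \<ge> 1"
    using F(2) p(1) finN by (metis One_nat_def Suc_leI card_gt_0_iff finite_Int)
  then have c2: "card (N p - F) \<le> 2"
    using cN card_Diff_subset_Int[of "N p" F] finN by auto
  have img: "\<phi> x \<in> N p - F" if "\<phi> \<in> Aut V E" "\<forall>y\<in>F. \<phi> y = y" "x \<in> N p - F" for \<phi> x
  proof -
    have "(p, \<phi> x) \<in> E" using that p(1) Aut_edge[OF that(1), of p x] by auto
    moreover have "\<phi> x \<notin> F" using that Aut_eq_iff by (metis DiffD2)
    ultimately show ?thesis by auto
  qed
  obtain w where w: "w \<in> N p - F" using p(2) by blast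
  show thesis
  proof (cases "N p - F = {w}")
    case True
    then show ?thesis using that[OF p(1) w] img by (metis w singletonD)
  next
    case False
    then obtain w' where w': "w' \<in> N p - F" "w' \<noteq> w" using w by blast
    have eq: "N p - F = {w, w'}"
      using w w' c2 finN
      by (intro card_seteq[symmetric]) auto
    then have "N w \<inter> F \<noteq> N w' \<inter> F"
      using p(1,3) w'(2) unfolding twin_def by blast
    then obtain q x x' where q: "q \<in> F" "(q, x) \<in> E" "(q, x') \<notin> E" "{x, x'} = {w, w'}"
      using edge_sym by (auto simp: set_eq_iff)
    have "\<phi> x = x" if "\<phi> \<in> Aut V E" "\<forall>y\<in>F. \<phi> y = y" for \<phi>
    proof -
      have "(q, \<phi> x) \<in> E" using q Aut_edge that by metis
      moreover have "\<phi> x \<in> {x, x'}" using img[OF that, of x] q(4) eq by auto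
      ultimately show ?thesis using q by auto
    qed
    moreover have "x \<in> N p - F" using q eq by auto
    ultimately show ?thesis using that[OF p(1)] by blast
  qed
qed

text \<open>The members of \<open>\<B>\<close> are the sets that would make another vertex look like the root. Since
  vertices become black only if they are exchangeable with a white one, it suffices to
  find, in a stalled situation, one such pair that does no harm.\<close>

lemma greedy_coloring:
  assumes S0: "single_valued S0" "Domain S0 \<subseteq> V" "S0 \<noteq> {}"
      "\<And>x. x \<in> Domain S0 \<Longrightarrow> N x \<inter> Domain S0 \<noteq> {}"
    and H: "H \<subseteq> Aut V E" "\<And>\<phi> x. \<phi> \<in> H \<Longrightarrow> x \<in> Domain S0 \<Longrightarrow> \<phi> x = x"
    and fin: "\<And>X. X \<in> \<B> \<Longrightarrow> finite X"
    and avoid: "\<And>X. X \<in> \<B> \<Longrightarrow> \<not> X \<times> {True} \<subseteq> S0"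
    and split: "\<And>S p w w'. S0 \<subseteq> S \<Longrightarrow> Domain S \<subseteq> V \<Longrightarrow> stalled (Domain S) \<Longrightarrow>
      twin (Domain S) p w w' \<Longrightarrow>
      \<exists>p w w'. twin (Domain S) p w w' \<and> (\<forall>X\<in>\<B>. w \<in> X \<longrightarrow> \<not> (X - {w}) \<times> {True} \<subseteq> S)"
  obtains B where "\<And>x b. (x, b) \<in> S0 \<Longrightarrow> (x \<in> B) = b" "\<And>X. X \<in> \<B> \<Longrightarrow> \<not> X \<subseteq> B"
    "\<And>\<phi>. \<phi> \<in> H \<Longrightarrow> \<forall>x\<in>V. \<phi> x \<in> B \<longleftrightarrow> x \<in> B \<Longrightarrow> \<phi> = id"
proof -
  have "fixing H S0" by (rule fixingI) (use H in auto)
  then have "admissible H \<B> S0 S0" unfolding admissible_def using S0 avoid by auto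
  then have ne: "{S. admissible H \<B> S0 S} \<noteq> {}" by blast
  \<comment> \<open>Zorn's lemma serves finite and infinite graphs alike; a maximal colouring turns
    out to be total.\<close>
  have "\<exists>M\<in>{S. admissible H \<B> S0 S}. \<forall>X\<in>{S. admissible H \<B> S0 S}. M \<subseteq> X \<longrightarrow> X = M"
    by (rule subset_Zorn_nonempty[OF ne]) (use admissible_Union fin in blast)
  then obtain M where M: "admissible H \<B> S0 M"
    and maximal: "\<And>S. admissible H \<B> S0 S \<Longrightarrow> M \<subseteq> S \<Longrightarrow> S = M" by blast
  let ?F = "Domain M"
  have FV: "?F \<subseteq> V" and Fn: "\<forall>x\<in>?F. N x \<inter> ?F \<noteq> {}" and sv: "single_valued M"
    and av: "\<And>X. X \<in> \<B> \<Longrightarrow> \<not> X \<times> {True} \<subseteq> M" and S0M: "S0 \<subseteq> M" and fx: "fixing H M"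
    using M unfolding admissible_def by auto
  \<comment> \<open>Otherwise a determined vertex could be added in white, which completes no black
    set.\<close>
  have st: "stalled ?F"
  proof (rule ccontr)
    assume "\<not> stalled ?F"
    then obtain p w where pw: "p \<in> ?F" "w \<in> N p - ?F"
      "\<And>\<phi>. \<phi> \<in> Aut V E \<Longrightarrow> \<forall>y\<in>?F. \<phi> y = y \<Longrightarrow> \<phi> w = w"
      using not_stalled_obtains FV Fn by metis
    have av': "\<not> X \<times> {True} \<subseteq> M \<union> {(w, False)}" if "X \<in> \<B>" for X
      using av[OF that] by blast
    have "admissible H \<B> S0 (M \<union> {(w, False)})" "M \<union> {(w, False)} \<noteq> M"
      by (rule admissible_extend[OF M H(1)]; use pw av' H(1) in \<open>auto simp: single_valued_def\<close>)+
    then show False using maximal by blast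
  qed
  \<comment> \<open>At the boundary of a stalled proper domain there is a twin pair; colouring a
    harmless one contradicts maximality.\<close>
  have FeqV: "?F = V"
  proof (rule ccontr)
    assume "?F \<noteq> V"
    moreover have "?F \<noteq> {}" using S0(3) S0M by auto
    ultimately obtain p y where "p \<in> ?F" "(p, y) \<in> E" "y \<notin> ?F"
      using connected_closed[OF FV] by blast
    then have p: "p \<in> ?F" "N p - ?F \<noteq> {}" by auto
    have "\<exists>w w'. twin ?F p w w'" using bspec[OF st[unfolded stalled_def] p(1)] p(2) by simp
    then have "\<exists>p w w'. twin ?F p w w' \<and> (\<forall>X\<in>\<B>. w \<in> X \<longrightarrow> \<not> (X - {w}) \<times> {True} \<subseteq> M)"
      using split[OF S0M FV st] by (elim exE)
    then obtain p w w' where tw: "twin ?F p w w'"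
      and good: "\<And>X. X \<in> \<B> \<Longrightarrow> w \<in> X \<Longrightarrow> \<not> (X - {w}) \<times> {True} \<subseteq> M"
      by (elim exE conjE) metis
    let ?T = "{(w, True), (w', False)}"
    have av': "\<not> X \<times> {True} \<subseteq> M \<union> ?T" if "X \<in> \<B>" for X
      using av[OF that] good[OF that] by blast
    have tw': "p \<in> ?F" "w \<noteq> w'" "N p - ?F = {w, w'}" using tw unfolding twin_def by auto
    then have pE: "(p, w) \<in> E" "(p, w') \<in> E" "w \<notin> ?F" "w' \<notin> ?F" by auto
    have fixT: "\<phi> x = x"
      if "\<phi> \<in> H" "\<forall>y\<in>?F. \<phi> y = y" "x \<in> {w, w'}" "\<forall>y\<in>V. \<phi> y \<in> B \<longleftrightarrow> y \<in> B"
        "w \<in> B" "w' \<notin> B" for \<phi> x B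
    proof -
      have A: "\<phi> \<in> Aut V E" using that H by blast
      have "(p, \<phi> x) \<in> E" using that pE tw'(1) Aut_edge[OF A, of p x] by auto
      moreover have "\<phi> x \<notin> ?F"
      proof
        assume "\<phi> x \<in> ?F"
        with that(2) have "\<phi> x = x" using Aut_eq_iff[OF A, of "\<phi> x" x] by simp
        with \<open>\<phi> x \<in> ?F\<close> show False using that(3) pE(3,4) by auto
      qed
      ultimately have "\<phi> x \<in> {w, w'}" using tw'(3) by auto
      moreover have "\<phi> x \<in> B \<longleftrightarrow> x \<in> B" using that(3,4) pE edge_in by blast
      ultimately show ?thesis using that(3,5,6) by auto
    qed
    have "admissible H \<B> S0 (M \<union> ?T)" "M \<union> ?T \<noteq> M"
      by (rule admissible_extend[OF M H(1)]; use tw' pE av' fixT in \<open>auto simp: single_valued_def\<close>)+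
    then show False using maximal by blast
  qed
  let ?B = "{x. (x, True) \<in> M}"
  have agree: "(x \<in> ?B) = b" if "(x, b) \<in> M" for x b
    using that sv by (cases b) (auto dest: single_valuedD)
  show thesis
  proof
    show "(x \<in> ?B) = b" if "(x, b) \<in> S0" for x b using agree that S0M by blast
    show "\<not> X \<subseteq> ?B" if "X \<in> \<B>" for X using av[OF that] by blast
    fix \<phi> assume \<phi>: "\<phi> \<in> H" and pres: "\<forall>x\<in>V. \<phi> x \<in> ?B \<longleftrightarrow> x \<in> ?B"
    have "\<phi> x = x" if "x \<in> V" for x
      by (rule fixingD[OF fx, of ?B]) (use agree \<phi> pres that FeqV in auto)
    moreover have "\<phi> x = x" if "x \<notin> V" for x
      using that \<phi> H(1) by (auto simp: Aut_def permutes_def)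
    ultimately show "\<phi> = id" by (auto simp: fun_eq_iff)
  qed
qed

lemma stalled_twin:
  assumes "stalled F" "p \<in> F" "w \<in> N p - F"
  obtains w' where "twin F p w w'"
proof -
  obtain x x' where x: "twin F p x x'"
    using bspec[OF assms(1)[unfolded stalled_def] assms(2)] assms(3) by (elim disjE exE) auto
  then have "w = x \<or> w = x'" using assms(3) unfolding twin_def by auto
  then show ?thesis using x twin_sym[OF x] that by blast
qed

lemma no_good_splitD:
  assumes "\<not> (\<exists>p w w'. twin F p w w' \<and> (\<forall>X\<in>\<B>. w \<in> X \<longrightarrow> \<not> (X - {w}) \<times> {True} \<subseteq> S))"
    and "twin F p w w'"
  obtains X where "X \<in> \<B>" "w \<in> X" "(X - {w}) \<times> {True} \<subseteq> S"
  using assms by blast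

section \<open>Recognizable arcs\<close>

text \<open>The arc \<open>(r, s)\<close> is the only one in its orbit with two black ends.\<close>

lemma good_arc_two_distinguishable:
  assumes r: "r \<in> V" "(r, s) \<in> E"
    and out: "N r \<inter> Orb s = {s}" and inn: "N s \<inter> Orb r = {r}" and ind: "N r \<inter> Orb r = {}"
  shows "two_distinguishable V E"
proof -
  let ?H = "{\<phi> \<in> Aut V E. \<phi> r = r}"
  let ?S0 = "{(r, True), (s, True)}"
  let ?\<B> = "{{\<psi> r, \<psi> s} |\<psi>. \<psi> \<in> Aut V E \<and> \<psi> r \<noteq> r}"
  have out': "y = \<psi> s" if "\<psi> \<in> Aut V E" "(\<psi> r, y) \<in> E" "y \<in> Orb s" for \<psi> y
    using Aut_neighbors_Orb[OF that(1), of r s] that(2,3) out by auto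
  have inn': "y = \<psi> r" if "\<psi> \<in> Aut V E" "(\<psi> s, y) \<in> E" "y \<in> Orb r" for \<psi> y
    using Aut_neighbors_Orb[OF that(1), of s r] that(2,3) inn by auto
  have ind': False if "\<psi> \<in> Aut V E" "(\<psi> r, y) \<in> E" "y \<in> Orb r" for \<psi> y
    using Aut_neighbors_Orb[OF that(1), of r r] that(2,3) ind by auto
  have s_notin: "s \<notin> Orb r" using ind r(2) by auto
  have rs: "\<phi> s = s" if "\<phi> \<in> Aut V E" "\<phi> r = r" for \<phi>
  proof -
    have "(r, \<phi> s) \<in> E" using Aut_edge[OF that(1), of r s] that(2) r(2) by simp
    then show ?thesis using out'[OF Aut_id, of "\<phi> s"] Orb_I[OF that(1), of s] by simp
  qed
  have split: "\<exists>p w w'. twin (Domain S) p w w' \<and>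
        (\<forall>X\<in>?\<B>. w \<in> X \<longrightarrow> \<not> (X - {w}) \<times> {True} \<subseteq> S)"
    if tw: "twin (Domain S) p w w'" for S p w w'
  proof (rule ccontr)
    assume none: "\<not> ?thesis"
    \<comment> \<open>A black \<open>w\<close> does harm only as one end of an image arc whose other
      end is coloured already.\<close>
    have bad: "(\<exists>\<psi>\<in>Aut V E. w = \<psi> r \<and> \<psi> s \<in> Domain S) \<or> (\<exists>\<psi>\<in>Aut V E. w = \<psi> s \<and> \<psi> r \<in> Domain S)"
      if tw: "twin (Domain S) p w w'" for w w'
    proof -
      obtain X where X: "X \<in> ?\<B>" "w \<in> X" "(X - {w}) \<times> {True} \<subseteq> S"
        using no_good_splitD[OF none tw] .
      then obtain \<psi> where \<psi>: "\<psi> \<in> Aut V E" "X = {\<psi> r, \<psi> s}" by blast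
      have "\<psi> r \<noteq> \<psi> s" using Aut_eq_iff[OF \<psi>(1)] r(2) by auto
      moreover have "X - {w} \<subseteq> Domain S" using X(3) by blast
      ultimately have "w = \<psi> r \<and> \<psi> s \<in> Domain S \<or> w = \<psi> s \<and> \<psi> r \<in> Domain S"
        using X(2) \<psi>(2) by auto
      then show ?thesis using \<psi>(1) by blast
    qed
    have nb: "(y, w) \<in> E \<longleftrightarrow> (y, w') \<in> E" if "y \<in> Domain S" for y
      using tw that edge_sym[of y] unfolding twin_def by auto
    have ww: "w \<noteq> w'" using tw unfolding twin_def by blast
    \<comment> \<open>The coloured end of such an arc is adjacent to both twins. Ends of different
      kinds then contradict \<open>ind\<close>, two tails contradict \<open>inn\<close>, and two
      heads contradict \<open>out\<close>.\<close>
    have no: False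
      if "\<psi> \<in> Aut V E" "\<psi>' \<in> Aut V E" "\<psi> r \<in> {w, w'}" "\<psi>' s \<in> {w, w'}" "\<psi> r \<noteq> \<psi>' s" "\<psi>' r \<in> Domain S"
      for \<psi> \<psi>'
    proof -
      have "(\<psi>' r, \<psi>' s) \<in> E" using Aut_edge that(2) r(2) by blast
      then have "(\<psi>' r, \<psi> r) \<in> E" using nb[OF that(6)] that(3-5) by auto
      from ind'[OF that(2) this Orb_I[OF that(1)]] show False .
    qed
    have no_rr: False
      if "\<psi> \<in> Aut V E" "\<psi>' \<in> Aut V E" "w = \<psi> r" "w' = \<psi>' r" "\<psi> s \<in> Domain S" for \<psi> \<psi>'
    proof -
      have "(\<psi> s, \<psi> r) \<in> E" using Aut_edge that(1) r(2) edge_sym by blast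
      then have "(\<psi> s, \<psi>' r) \<in> E" using nb[OF that(5)] that by auto
      from inn'[OF that(1) this Orb_I[OF that(2)]] show False using ww that(3,4) by simp
    qed
    have no_ss: False
      if "\<psi> \<in> Aut V E" "\<psi>' \<in> Aut V E" "w = \<psi> s" "w' = \<psi>' s" "\<psi> r \<in> Domain S" for \<psi> \<psi>'
    proof -
      have "(\<psi> r, \<psi> s) \<in> E" using Aut_edge that(1) r(2) by blast
      then have "(\<psi> r, \<psi>' s) \<in> E" using nb[OF that(5)] that by auto
      from out'[OF that(1) this Orb_I[OF that(2)]] show False using ww that(3,4) by simp
    qed
    from bad[OF tw] bad[OF twin_sym[OF tw]] show False
    proof (elim disjE bexE conjE)
      fix \<psi> \<psi>'
      assume *: "\<psi> \<in> Aut V E" "\<psi>' \<in> Aut V E"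
      show False if "w = \<psi> r" "\<psi> s \<in> Domain S" "w' = \<psi>' r"
        using no_rr[OF *] that by simp
      show False if "w = \<psi> s" "\<psi> r \<in> Domain S" "w' = \<psi>' s"
        using no_ss[OF *] that by simp
      show False if "w = \<psi> r" "w' = \<psi>' s" "\<psi>' r \<in> Domain S"
        using no[OF *] that ww by simp
      show False if "w = \<psi> s" "\<psi> r \<in> Domain S" "w' = \<psi>' r"
        using no[OF *(2,1)] that ww by simp
    qed
  qed
  obtain B where B: "\<And>x b. (x, b) \<in> ?S0 \<Longrightarrow> (x \<in> B) = b" "\<And>X. X \<in> ?\<B> \<Longrightarrow> \<not> X \<subseteq> B"
    "\<And>\<phi>. \<phi> \<in> ?H \<Longrightarrow> \<forall>x\<in>V. \<phi> x \<in> B \<longleftrightarrow> x \<in> B \<Longrightarrow> \<phi> = id"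
  proof (rule greedy_coloring[of ?S0 ?H ?\<B>])
    show "single_valued ?S0" by (auto simp: single_valued_def)
    show "Domain ?S0 \<subseteq> V" using r edge_in(2) by auto
    show "N x \<inter> Domain ?S0 \<noteq> {}" if "x \<in> Domain ?S0" for x
      using that r(2) edge_sym[of r s] by auto
    show "\<phi> x = x" if "\<phi> \<in> ?H" "x \<in> Domain ?S0" for \<phi> x using that rs by auto
    show "\<not> X \<times> {True} \<subseteq> ?S0" if X: "X \<in> ?\<B>" for X
    proof
      assume sub: "X \<times> {True} \<subseteq> ?S0"
      obtain \<psi> where \<psi>: "\<psi> \<in> Aut V E" "\<psi> r \<noteq> r" "X = {\<psi> r, \<psi> s}" using X by blast
      \<comment> \<open>Black pairs are unordered, so the reversed reading of the arc has to be
        excluded.\<close>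
      then have "\<psi> r = s" using sub by auto
      then show False using s_notin Orb_I[OF \<psi>(1), of r] by simp
    qed
  qed (use split in \<open>auto\<close>)
  have "\<phi> = id" if \<phi>: "\<phi> \<in> Aut V E" and pres: "\<forall>x\<in>V. \<phi> x \<in> B \<longleftrightarrow> x \<in> B" for \<phi>
  proof -
    have "\<phi> r \<in> B" "\<phi> s \<in> B" using pres B(1) r edge_in(2) by auto
    then have "\<phi> r = r" using B(2)[of "{\<phi> r, \<phi> s}"] \<phi> by blast
    then show ?thesis using B(3) \<phi> pres by blast
  qed
  then show ?thesis unfolding two_distinguishable_def by blast
qed

end

section \<open>Vertices of valence 2 and type 1\<close>

locale type_one_vertex = subcubic_graph +
  fixes v a b :: 'a
  assumes v_in: "v \<in> V" and N_v: "neighbors E v = {a, b}" and a_neq_b: "a \<noteq> b"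
    and stab: "\<phi> \<in> Aut V E \<Longrightarrow> \<phi> v = v \<Longrightarrow> \<phi> a = a \<and> \<phi> b = b"
begin

lemma v_edges: "(v, x) \<in> E \<longleftrightarrow> x = a \<or> x = b" "(x, v) \<in> E \<longleftrightarrow> x = a \<or> x = b"
  using N_v edge_sym[of x v] unfolding set_eq_iff by auto

lemma a_in: "a \<in> V" and b_in: "b \<in> V"
  using v_edges edge_in by blast+

lemma v_neq: "v \<noteq> a" "v \<noteq> b"
  using v_edges edge_irrefl by blast+

text \<open>Otherwise swapping \<open>a\<close> and \<open>b\<close> would be an automorphism that
  fixes \<open>v\<close>, against type 1.\<close>

lemma no_twin_neighbors: "N a - {b} \<noteq> N b - {a}"
proof
  assume "N a - {b} = N b - {a}"
  then have "transpose a b \<in> Aut V E" using Aut_transpose a_in b_in by blast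
  then show False using stab[of "transpose a b"] v_neq a_neq_b by auto
qed

section \<open>Marking \<open>v\<close> by a black closed neighbourhood\<close>

text \<open>If blackening a twin completes a black closed neighbourhood, the twin is its centre,
  since a coloured centre would have a single uncoloured neighbour. If this happens for both twins,
  their neighbours are all coloured and hence the same, which \<open>no_square\<close>
  forbids.\<close>

lemma two_distinguishable_generic:
  assumes no_triangle: "N a \<noteq> {v, b}" "N b \<noteq> {v, a}"
    and no_square: "\<And>x. N x = N v \<Longrightarrow> x = v"
  shows "two_distinguishable V E"
proof -
  let ?H = "{\<phi> \<in> Aut V E. \<phi> v = v}"
  let ?S0 = "{(v, True), (a, True), (b, True)}"
  let ?\<B> = "{insert u (N u) |u. u \<in> Orb v \<and> u \<noteq> v}"
  have no_square': "w = w'" if "w \<in> Orb v" "N w = N w'" for w w'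
  proof -
    obtain \<psi> where \<psi>: "\<psi> \<in> Aut V E" "w = \<psi> v" using \<open>w \<in> Orb v\<close> unfolding orbit_def by blast
    have "N (inv \<psi> w') = N (inv \<psi> w)" using that Aut_neighbors[OF Aut_inv[OF \<psi>(1)]] by simp
    then show ?thesis using no_square[of "inv \<psi> w'"] \<psi> Aut_inv_eq[OF \<psi>(1)] by metis
  qed
  have card_orb: "card (N u) = 2" if "u \<in> Orb v" for u
    using that a_neq_b N_v unfolding orbit_def
    by (auto simp: Aut_neighbors Aut_eq_iff)
  have split: "\<exists>p w w'. twin (Domain S) p w w' \<and>
        (\<forall>X\<in>?\<B>. w \<in> X \<longrightarrow> \<not> (X - {w}) \<times> {True} \<subseteq> S)"
    if st: "stalled (Domain S)" and tw: "twin (Domain S) p w w'" for S p w w'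
  proof (rule ccontr)
    assume none: "\<not> ?thesis"
    have bad: "w \<in> Orb v \<and> N w \<subseteq> Domain S"
      if tw: "twin (Domain S) p w w'" for w w'
    proof -
      obtain X where X: "X \<in> ?\<B>" "w \<in> X" "(X - {w}) \<times> {True} \<subseteq> S"
        using no_good_splitD[OF none tw] .
      then obtain u where u: "u \<in> Orb v" "X = insert u (N u)" by blast
      have wF: "w \<notin> Domain S" using tw unfolding twin_def by blast
      have D: "X - {w} \<subseteq> Domain S" using X(3) by blast
      have "u = w"
      proof (rule ccontr)
        assume "u \<noteq> w"
        then have "w \<in> N u" and "u \<in> Domain S" using X(2) u(2) D by auto
        moreover have "N u - Domain S \<subseteq> {w}" using D u(2) by blast
        moreover have "w \<in> N u - Domain S" using \<open>w \<in> N u\<close> wF by simp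
        ultimately obtain y where "twin (Domain S) u w y" using stalled_twin[OF st] by metis
        then show False using \<open>N u - Domain S \<subseteq> {w}\<close> unfolding twin_def by auto
      qed
      then show ?thesis using u D by auto
    qed
    have "w \<in> Orb v" "N w \<subseteq> Domain S" "N w' \<subseteq> Domain S"
      using bad[OF tw] bad[OF twin_sym[OF tw]] by auto
    moreover have "N w \<inter> Domain S = N w' \<inter> Domain S" "w \<noteq> w'" using tw unfolding twin_def by auto
    ultimately show False using no_square'[of w w'] by blast
  qed
  obtain B where B: "\<And>x b. (x, b) \<in> ?S0 \<Longrightarrow> (x \<in> B) = b" "\<And>X. X \<in> ?\<B> \<Longrightarrow> \<not> X \<subseteq> B"
    "\<And>\<phi>. \<phi> \<in> ?H \<Longrightarrow> \<forall>x\<in>V. \<phi> x \<in> B \<longleftrightarrow> x \<in> B \<Longrightarrow> \<phi> = id"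
  proof (rule greedy_coloring[of ?S0 ?H ?\<B>])
    show "single_valued ?S0" by (auto simp: single_valued_def)
    show "Domain ?S0 \<subseteq> V" using v_in a_in b_in by auto
    show "N x \<inter> Domain ?S0 \<noteq> {}" if "x \<in> Domain ?S0" for x
      using that v_edges by auto
    show "\<phi> x = x" if "\<phi> \<in> ?H" "x \<in> Domain ?S0" for \<phi> x using that stab by auto
    show "finite X" if X: "X \<in> ?\<B>" for X
      using X finite_neighbors Orb_subset[OF v_in] by auto
    show "\<not> X \<times> {True} \<subseteq> ?S0" if X: "X \<in> ?\<B>" for X
    proof
      assume sub: "X \<times> {True} \<subseteq> ?S0"
      obtain u where u: "u \<in> Orb v" "u \<noteq> v" "X = insert u (N u)" using X by blast
      \<comment> \<open>At the start only \<open>a\<close> or \<open>b\<close> could be another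
        black centre, and that would need the excluded triangle.\<close>
      have *: "insert u (N u) \<subseteq> {v, a, b}" using sub u(3) by auto
      then consider "u = a" | "u = b" using u(2) by auto
      then show False
      proof cases
        case 1
        then have "N a \<subseteq> {v, b}" using * edge_irrefl by fastforce
        then have "N a = {v, b}" by (rule card_seteq[rotated]) (use card_orb[OF u(1)] 1 v_neq in auto)
        then show False using no_triangle by blast
      next
        case 2
        then have "N b \<subseteq> {v, a}" using * edge_irrefl by fastforce
        then have "N b = {v, a}" by (rule card_seteq[rotated]) (use card_orb[OF u(1)] 2 v_neq in auto)
        then show False using no_triangle by blast
      qed
    qed
  qed (use split in \<open>auto\<close>)
  have "\<phi> = id" if \<phi>: "\<phi> \<in> Aut V E" and pres: "\<forall>x\<in>V. \<phi> x \<in> B \<longleftrightarrow> x \<in> B" for \<phi>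
  proof -
    have "\<phi> v \<in> B" "\<phi> a \<in> B" "\<phi> b \<in> B" using pres B(1) v_in a_in b_in by auto
    then have "insert (\<phi> v) (N (\<phi> v)) \<subseteq> B" using Aut_neighbors[OF \<phi>, of v] N_v by auto
    then have "\<phi> v = v" using B(2)[of "insert (\<phi> v) (N (\<phi> v))"] Orb_I[OF \<phi>, of v] by blast
    then show ?thesis using B(3) \<phi> pres by blast
  qed
  then show ?thesis unfolding two_distinguishable_def by blast
qed

section \<open>Another vertex with the same two neighbours\<close>

text \<open>Marking the pair \<open>{a, b}\<close> determines \<open>v\<close> only up to
  \<open>v'\<close>; therefore \<open>v'\<close> starts out white.\<close>

lemma two_distinguishable_square:
  assumes v': "v' \<noteq> v" "N v' = N v"
  shows "two_distinguishable V E"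
proof -
  let ?H = "{\<phi> \<in> Aut V E. \<phi> v = v}"
  let ?S0 = "{(v, True), (v', False), (a, True), (b, True)}"
  let ?\<B> = "{{\<psi> a, \<psi> b} |\<psi>. \<psi> \<in> Aut V E \<and> {\<psi> a, \<psi> b} \<noteq> {a, b}}"
  have v'_edges: "(v', x) \<in> E \<longleftrightarrow> x = a \<or> x = b" "(x, v') \<in> E \<longleftrightarrow> x = a \<or> x = b" for x
    using v'(2) N_v edge_sym[of x v'] unfolding set_eq_iff by auto
  have v'_in: "v' \<in> V" using v'_edges edge_in by blast
  have v'_neq: "v' \<noteq> a" "v' \<noteq> b" using v'_edges edge_irrefl by blast+
  \<comment> \<open>Three common neighbours would exhaust the valences of \<open>a\<close> and
    \<open>b\<close> and make them twins.\<close>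
  have third: "x = v \<or> x = v'" if "N x = {a, b}" for x
  proof (rule ccontr)
    assume x: "\<not> ?thesis"
    have xe: "(x, y) \<in> E \<longleftrightarrow> y = a \<or> y = b" "(y, x) \<in> E \<longleftrightarrow> y = a \<or> y = b" for y
      using that edge_sym[of y x] unfolding set_eq_iff by auto
    have "card {v, v', x} = 3" using x v' by auto
    then have c3: "card (N a) \<le> card {v, v', x}" "card (N b) \<le> card {v, v', x}"
      using card_neighbors_le a_in b_in by auto
    have "{v, v', x} = N a" "{v, v', x} = N b"
      using c3 by (intro card_seteq; use finite_neighbors a_in b_in v_edges v'_edges xe in auto)+
    moreover have "a \<notin> {v, v', x}" "b \<notin> {v, v', x}" using v_neq v'_neq xe edge_irrefl by blast+
    ultimately show False using no_twin_neighbors by simp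
  qed
  have fix_v': "\<phi> v' = v'" if "\<phi> \<in> Aut V E" "\<phi> v = v" for \<phi>
  proof -
    have "N (\<phi> v') = {a, b}" using Aut_neighbors[OF that(1), of v'] v'(2) N_v stab[OF that] by simp
    then have "\<phi> v' \<in> {v, v'}" using third by blast
    moreover have "\<phi> v' \<noteq> v" using that v'(1) Aut_eq_iff[OF that(1), of v' v] by simp
    ultimately show ?thesis by simp
  qed
  \<comment> \<open>Every forbidden pair is the whole neighbourhood of two vertices, the images of
    \<open>v\<close> and \<open>v'\<close>.\<close>
  have B_twins: "\<exists>u u'. u \<noteq> u' \<and> N u = {w, z} \<and> N u' = {w, z} \<and> w \<noteq> z"
    if X: "X \<in> ?\<B>" and wX: "w \<in> X" and z: "(X - {w}) = {z}" for X w z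
  proof -
    obtain \<psi> where \<psi>: "\<psi> \<in> Aut V E" "X = {\<psi> a, \<psi> b}" using X by blast
    have "N (\<psi> v) = {w, z}" "N (\<psi> v') = {w, z}"
      using Aut_neighbors[OF \<psi>(1)] N_v v'(2) wX z \<psi>(2) by auto
    moreover have "\<psi> v \<noteq> \<psi> v'" using Aut_eq_iff[OF \<psi>(1)] v'(1) by auto
    ultimately show ?thesis using z by blast
  qed
  have B_other: "\<exists>z. X - {w} = {z}" if X: "X \<in> ?\<B>" and wX: "w \<in> X" for X w
  proof -
    obtain \<psi> where \<psi>: "\<psi> \<in> Aut V E" "X = {\<psi> a, \<psi> b}" using X by blast
    then show ?thesis using wX Aut_eq_iff[OF \<psi>(1), of a b] a_neq_b by auto
  qed
  have split: "\<exists>p w w'. twin (Domain S) p w w' \<and>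
        (\<forall>X\<in>?\<B>. w \<in> X \<longrightarrow> \<not> (X - {w}) \<times> {True} \<subseteq> S)"
    if st: "stalled (Domain S)" and tw: "twin (Domain S) p w w'" for S p w w'
  proof (rule ccontr)
    assume none: "\<not> ?thesis"
    have bad: "\<exists>z u u'. u \<noteq> u' \<and> z \<in> Domain S \<and> N u = {w, z} \<and> N u' = {w, z} \<and> w \<noteq> z"
      if tw: "twin (Domain S) p w w'" for p w w'
    proof -
      obtain X where X: "X \<in> ?\<B>" "w \<in> X" "(X - {w}) \<times> {True} \<subseteq> S"
        using no_good_splitD[OF none tw] .
      then obtain z where z: "X - {w} = {z}" using B_other by blast
      then have "z \<in> Domain S" using X(3) by blast
      then show ?thesis using B_twins[OF X(1,2) z] by blast
    qed
    \<comment> \<open>If blackening \<open>w\<close> completes a black pair with \<open>z\<close>, the common neighbours of \<open>w\<close> and \<open>z\<close> are a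
      harmless pair.\<close>
    obtain z u u' where u: "u \<noteq> u'" "z \<in> Domain S" "N u = {w, z}" "N u' = {w, z}" "w \<noteq> z"
      using bad[OF tw] by blast
    have wF: "w \<notin> Domain S" using tw unfolding twin_def by blast
    \<comment> \<open>A coloured \<open>y\<close> would have \<open>w\<close> as its only uncoloured
      neighbour.\<close>
    have notF: "y \<notin> Domain S" if "N y = {w, z}" for y
    proof
      assume y: "y \<in> Domain S"
      have eq: "N y - Domain S = {w}" using that u(2) wF by auto
      then have "w \<in> N y - Domain S" by simp
      then obtain x where "twin (Domain S) y w x" using stalled_twin[OF st y] by metis
      then show False using eq unfolding twin_def by auto
    qed
    have "(z, u) \<in> E" "(z, u') \<in> E" using u(3,4) edge_sym[of z] unfolding set_eq_iff by auto
    then have uz: "u \<in> N z - Domain S" "u' \<in> N z - Domain S" using notF u(3,4) by auto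
    then obtain x where "twin (Domain S) z u x" using stalled_twin[OF st u(2)] by metis
    moreover have "x = u'" using calculation uz(2) u(1) unfolding twin_def by auto
    ultimately have "twin (Domain S) z u u'" by simp
    \<comment> \<open>If \<open>u\<close> were harmful too, \<open>g\<close> and \<open>g'\<close>
      would be the two neighbours of \<open>u\<close>, so \<open>z\<close> would be one of them.
      Then \<open>z\<close> has only the neighbours \<open>u\<close> and the coloured
      \<open>y\<close>, although \<open>u'\<close> is an uncoloured neighbour of
      \<open>z\<close>.\<close>
    then obtain y g g' where g: "g \<noteq> g'" "y \<in> Domain S" "N g = {u, y}" "N g' = {u, y}"
      using bad by metis
    have "u \<in> N g" "u \<in> N g'" using g(3,4) by simp_all
    then have "g \<in> N u" "g' \<in> N u" using edge_sym by (simp_all only: neighbors_iff)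
    then have "z = g \<or> z = g'" using g(1) unfolding u(3) by auto
    then have "N z = {u, y}" using g(3,4) by metis
    then have "u' = y" using uz(2) u(1) by auto
    then show False using uz(2) g(2) by simp
  qed
  obtain B where B: "\<And>x b. (x, b) \<in> ?S0 \<Longrightarrow> (x \<in> B) = b" "\<And>X. X \<in> ?\<B> \<Longrightarrow> \<not> X \<subseteq> B"
    "\<And>\<phi>. \<phi> \<in> ?H \<Longrightarrow> \<forall>x\<in>V. \<phi> x \<in> B \<longleftrightarrow> x \<in> B \<Longrightarrow> \<phi> = id"
  proof (rule greedy_coloring[of ?S0 ?H ?\<B>])
    show "single_valued ?S0" using v'(1) v'_neq by (auto simp: single_valued_def)
    show "Domain ?S0 \<subseteq> V" using v_in a_in b_in v'_in by auto
    show "N x \<inter> Domain ?S0 \<noteq> {}" if "x \<in> Domain ?S0" for x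
      using that v_edges v'_edges by auto
    show "\<phi> x = x" if "\<phi> \<in> ?H" "x \<in> Domain ?S0" for \<phi> x using that stab fix_v' by auto
    show "\<not> X \<times> {True} \<subseteq> ?S0" if X: "X \<in> ?\<B>" for X
    proof
      assume sub: "X \<times> {True} \<subseteq> ?S0"
      obtain \<psi> where \<psi>: "\<psi> \<in> Aut V E" "X = {\<psi> a, \<psi> b}" "{\<psi> a, \<psi> b} \<noteq> {a, b}" using X by blast
      have "X \<subseteq> {v, a, b}" using sub by auto
      moreover have "\<psi> a \<noteq> \<psi> b" using Aut_eq_iff[OF \<psi>(1)] a_neq_b by blast
      ultimately have vX: "v \<in> X" using \<psi> by auto
      then obtain z where z: "X - {v} = {z}" using B_other X by blast
      have zab: "z = a \<or> z = b" using z \<open>X \<subseteq> {v, a, b}\<close> by blast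
      \<comment> \<open>Both common neighbours of \<open>v\<close> and \<open>z\<close> lie in
        \<open>{a, b}\<close>, so one of them would be \<open>z\<close> itself.\<close>
      obtain u u' where u: "u \<noteq> u'" "N u = {v, z}" "N u' = {v, z}" using B_twins[OF X vX z] by blast
      have "(v, u) \<in> E" "(v, u') \<in> E" "(z, u) \<in> E" "(z, u') \<in> E"
        using u(2,3) edge_sym[of v] edge_sym[of z] unfolding set_eq_iff by auto
      then show False using v_edges zab u(1) edge_irrefl by metis
    qed
  qed (use split in \<open>auto\<close>)
  have "\<phi> = id" if \<phi>: "\<phi> \<in> Aut V E" and pres: "\<forall>x\<in>V. \<phi> x \<in> B \<longleftrightarrow> x \<in> B" for \<phi>
  proof -
    have col: "\<phi> v \<in> B" "v' \<notin> B" "\<phi> a \<in> B" "\<phi> b \<in> B" using pres B(1) v_in a_in b_in by auto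
    then have "{\<phi> a, \<phi> b} = {a, b}" using B(2)[of "{\<phi> a, \<phi> b}"] \<phi> by blast
    then have "N (\<phi> v) = {a, b}" using Aut_neighbors[OF \<phi>, of v] N_v by auto
    then have "\<phi> v = v" using third col by blast
    then show ?thesis using B(3) \<phi> pres by blast
  qed
  then show ?thesis unfolding two_distinguishable_def by blast
qed

end

section \<open>Triangles with two vertices of valence 2\<close>

locale triangle_vertex = type_one_vertex +
  assumes N_a: "neighbors E a = {v, b}"
begin

lemma a_edges: "(a, x) \<in> E \<longleftrightarrow> x = v \<or> x = b" "(x, a) \<in> E \<longleftrightarrow> x = v \<or> x = b"
  using N_a edge_sym[of x a] unfolding set_eq_iff by auto

lemma a_Orb: "a \<in> Orb v"
proof -
  have "N v - {a} = N a - {v}" using N_v N_a a_neq_b v_neq by auto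
  then have "transpose v a \<in> Aut V E" by (rule Aut_transpose[OF v_in a_in])
  from Orb_I[OF this, of v] show ?thesis by simp
qed

lemma card_N_v: "card (N v) = 2"
  using N_v a_neq_b by simp

text \<open>Without a third neighbour of \<open>b\<close>, the vertices \<open>a\<close> and
  \<open>b\<close> would be twins, against type 1.\<close>

lemma card_N_b: "card (N b) = 3"
proof -
  have sub: "{v, a} \<subseteq> N b" using v_edges a_edges edge_sym[of b] by auto
  have fin: "finite (N b)" using finite_neighbors b_in by blast
  have "N b \<noteq> {v, a}" using no_twin_neighbors N_a v_neq a_neq_b by auto
  then have "{v, a} \<subset> N b" using sub by blast
  from psubset_card_mono[OF fin this] show ?thesis
    using card_neighbors_le[OF b_in] v_neq by simp
qed

lemma b_notin_Orb: "b \<notin> Orb v"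
  using card_neighbors_Orb(1)[of b v] card_N_v card_N_b by auto

lemma a_notin_Orb: "a \<notin> Orb b"
  using card_neighbors_Orb(1)[of a b] card_neighbors_Orb(1)[OF a_Orb] card_N_v card_N_b by auto

text \<open>A third neighbour \<open>c\<close> of \<open>b\<close> in this orbit would form a
  triangle with \<open>b\<close> and another neighbour of \<open>b\<close>, hence with
  \<open>v\<close> or \<open>a\<close>; but these have no neighbours outside their own
  triangle.\<close>

lemma N_b_Orb: "N b \<inter> Orb v = {v, a}"
proof
  show "{v, a} \<subseteq> N b \<inter> Orb v"
    using v_edges a_edges edge_sym[of b] a_Orb Orb_self[of v] by auto
  show "N b \<inter> Orb v \<subseteq> {v, a}"
  proof
    fix c assume c: "c \<in> N b \<inter> Orb v"
    show "c \<in> {v, a}"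
    proof (rule ccontr)
      assume nc: "c \<notin> {v, a}"
      obtain \<psi> where \<psi>: "\<psi> \<in> Aut V E" "c = \<psi> v" using c Orb_obtain by blast
      have Nc: "N c = {\<psi> a, \<psi> b}" using Aut_neighbors[OF \<psi>(1), of v] N_v \<psi>(2) by simp
      have aO: "\<psi> a \<in> Orb v" using Orb_image_iff[OF \<psi>(1)] a_Orb by simp
      have "b \<in> N c" using c edge_sym[of b c] by simp
      then have bb: "b = \<psi> b" using Nc aO b_notin_Orb by auto
      have "(\<psi> a, \<psi> b) \<in> E" using Aut_edge[OF \<psi>(1), of a b] a_edges by simp
      then have ab: "\<psi> a \<in> N b" using bb edge_sym[of b] by simp
      have "\<psi> a \<in> N c" using Nc by simp
      then have ca: "(c, \<psi> a) \<in> E" by simp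
      have "{v, a, c} = N b"
      proof (rule card_seteq)
        show "finite (N b)" using finite_neighbors b_in by blast
        show "{v, a, c} \<subseteq> N b" using v_edges a_edges edge_sym[of b] c by auto
        show "card (N b) \<le> card {v, a, c}" using card_N_b nc v_neq by auto
      qed
      then have "\<psi> a = v \<or> \<psi> a = a" using ab ca edge_irrefl by auto
      then have "c = b" using ca v_edges(2)[of c] a_edges(2)[of c] nc by auto
      then show False using c by simp
    qed
  qed
qed

section \<open>The chain above \<open>v\<close> and the orbits of its members\<close>

text \<open>The chain climbs the finite binary trees hanging at the triangle of \<open>v\<close>. The choice of
  \<open>chain (Suc (Suc i))\<close> is meaningful, and unique, only while \<open>live (Suc i)\<close> holds.\<close>

fun chain :: "nat \<Rightarrow> 'a" where
  "chain 0 = v"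
| "chain (Suc 0) = b"
| "chain (Suc (Suc i)) = (SOME z. z \<in> N (chain (Suc i)) - Orb (chain i))"

definition climbs :: "nat \<Rightarrow> bool" where
  "climbs i \<longleftrightarrow> card (N (chain (Suc i))) = 3 \<and> card (N (chain (Suc i)) \<inter> Orb (chain i)) = 2"

text \<open>The index is shifted: \<open>climbs j\<close> speaks of \<open>chain (Suc j)\<close>, so
  \<open>live i\<close> guarantees a well-determined chain up to and including
  \<open>chain (Suc i)\<close>.\<close>

definition live :: "nat \<Rightarrow> bool" where
  "live i \<longleftrightarrow> (\<forall>j<i. climbs j)"

lemma live_0: "live 0"
  by (simp add: live_def)

lemma live_Suc: "live (Suc i) \<longleftrightarrow> live i \<and> climbs i"
  by (auto simp: live_def less_Suc_eq)

lemma live_mono: "live j \<Longrightarrow> i \<le> j \<Longrightarrow> live i"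
  by (auto simp: live_def)

lemma climbs_0: "climbs 0"
  using card_N_b N_b_Orb v_neq by (simp add: climbs_def)

text \<open>A second neighbour in the orbit of the next vertex would lie in the preceding orbit, so
  that the two orbits would coincide. Consequently an automorphism that fixes \<open>chain i\<close>
  fixes \<open>chain (Suc i)\<close>.\<close>

lemma chain_step:
  assumes "live i"
  shows "chain i \<in> V" "(chain i, chain (Suc i)) \<in> E"
    "N (chain i) \<inter> Orb (chain (Suc i)) = {chain (Suc i)}"
    "i > 0 \<Longrightarrow> N (chain i) - Orb (chain (i - 1)) = {chain (Suc i)}"
proof -
  have "chain i \<in> V \<and> (chain i, chain (Suc i)) \<in> E \<and>
    N (chain i) \<inter> Orb (chain (Suc i)) = {chain (Suc i)} \<and>
    (i > 0 \<longrightarrow> N (chain i) - Orb (chain (i - 1)) = {chain (Suc i)})"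
    using assms
  proof (induction i)
    case 0
    show ?case using v_in v_edges N_v a_notin_Orb Orb_self[of b] by auto
  next
    case (Suc j)
    let ?A = "N (chain (Suc j))" and ?O = "Orb (chain j)"
    from Suc have IH: "(chain j, chain (Suc j)) \<in> E" and cl: "climbs j" by (simp_all add: live_Suc)
    have inV: "chain (Suc j) \<in> V" using IH edge_in by blast
    then have fin: "finite ?A" using finite_neighbors by blast
    have "card (?A - ?O) = 1"
      using cl card_Diff_subset_Int[of ?A ?O] fin unfolding climbs_def by simp
    then obtain z where z: "?A - ?O = {z}" by (auto simp: card_1_singleton_iff)
    then have zc: "chain (Suc (Suc j)) = z" by (simp add: some_equality)
    have zO: "z \<notin> ?O" and zA: "z \<in> ?A" using z by blast+
    have only: "y = z" if "y \<in> ?A" "y \<in> Orb z" for y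
    proof (rule ccontr)
      assume "y \<noteq> z"
      then have "y \<notin> ?A - ?O" unfolding z by simp
      then have "y \<in> ?O" using that(1) by blast
      from Orb_eqI[OF this that(2)] have "z \<in> ?O" using Orb_self[of z] by simp
      then show False using zO by contradiction
    qed
    have "?A \<inter> Orb z = {z}"
    proof (intro equalityI subsetI)
      show "y \<in> {z}" if "y \<in> ?A \<inter> Orb z" for y using only[of y] that by blast
      show "y \<in> ?A \<inter> Orb z" if "y \<in> {z}" for y using that zA Orb_self[of z] by blast
    qed
    then have "N (chain (Suc j)) \<inter> Orb (chain (Suc (Suc j))) = {chain (Suc (Suc j))}"
      unfolding zc .
    moreover have "(chain (Suc j), chain (Suc (Suc j))) \<in> E" using zA unfolding zc by simp
    moreover have "N (chain (Suc j)) - Orb (chain (Suc j - 1)) = {chain (Suc (Suc j))}"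
      using z unfolding zc by simp
    ultimately show ?case using inV by blast
  qed
  then show "chain i \<in> V" "(chain i, chain (Suc i)) \<in> E"
    "N (chain i) \<inter> Orb (chain (Suc i)) = {chain (Suc i)}"
    "i > 0 \<Longrightarrow> N (chain i) - Orb (chain (i - 1)) = {chain (Suc i)}" by auto
qed

declare chain.simps(3) [simp del]

lemma chain_Suc_in: "live i \<Longrightarrow> chain (Suc i) \<in> V"
  using chain_step(2) edge_in by blast

lemma chain_outer:
  assumes "live (Suc i)"
  shows "N (chain (Suc i)) - Orb (chain i) = {chain (Suc (Suc i))}"
  using chain_step(4)[OF assms] by simp

lemma chain_inner:
  assumes "live (Suc i)" "y \<in> N (chain (Suc i))" "y \<noteq> chain (Suc (Suc i))"
  shows "y \<in> Orb (chain i)"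
proof (rule ccontr)
  assume "y \<notin> Orb (chain i)"
  then have "y \<in> {chain (Suc (Suc i))}" using assms(2) chain_outer[OF assms(1)] by blast
  then show False using assms(3) by simp
qed

lemma card_N_chain: "live (Suc i) \<Longrightarrow> card (N (chain (Suc i))) = 3"
  "live (Suc i) \<Longrightarrow> card (N (chain (Suc i)) \<inter> Orb (chain i)) = 2"
  by (simp_all add: live_Suc climbs_def)

text \<open>The first member has valence 2, the later live ones have valence 3. If two later ones
  shared an orbit, each would have two neighbours in either of the preceding orbits, which differ by
  induction, and so four neighbours.\<close>

lemma Orb_chain_neq:
  assumes "live j" "i < j"
  shows "Orb (chain i) \<noteq> Orb (chain j)"
  using assms
proof (induction i arbitrary: j)
  case 0
  then obtain k where k: "j = Suc k" by (cases j) auto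
  show ?case
  proof
    assume "Orb (chain 0) = Orb (chain j)"
    then have "chain j \<in> Orb v" using Orb_self by auto
    then show False using card_neighbors_Orb(1)[of "chain j" v] card_N_v card_N_chain(1) 0 k by simp
  qed
next
  case (Suc i)
  then obtain k where k: "j = Suc k" by (cases j) auto
  have lk: "live k" "i < k" using Suc.prems k by (auto simp: live_Suc)
  have li: "live (Suc i)" using Suc.prems live_mono[of j "Suc i"] by simp
  show ?case
  proof
    assume eq: "Orb (chain (Suc i)) = Orb (chain j)"
    then have "chain j \<in> Orb (chain (Suc i))" using Orb_self by auto
    then have c1: "card (N (chain j) \<inter> Orb (chain i)) = 2"
      using card_neighbors_Orb(2) card_N_chain(2)[OF li] by simp
    have c2: "card (N (chain j) \<inter> Orb (chain k)) = 2" "card (N (chain j)) = 3"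
      using card_N_chain Suc.prems(1) k by auto
    have fin: "finite (N (chain j))" using c2 card.infinite by fastforce
    have "Orb (chain i) \<inter> Orb (chain k) = {}"
      using Suc.IH[OF lk] Orb_eqI by blast
    then have "card ((N (chain j) \<inter> Orb (chain i)) \<union> (N (chain j) \<inter> Orb (chain k))) = 4"
      using c1 c2 fin by (subst card_Un_disjoint) auto
    moreover have "card ((N (chain j) \<inter> Orb (chain i)) \<union> (N (chain j) \<inter> Orb (chain k))) \<le> card (N (chain j))"
      by (rule card_mono[OF fin]) auto
    ultimately show False using c2 by simp
  qed
qed

lemma chain_index_eq:
  assumes "live i" "live j" "z \<in> Orb (chain i)" "z \<in> Orb (chain j)"
  shows "i = j"
proof (rule ccontr)
  assume "i \<noteq> j"
  then consider "i < j" | "j < i" by linarith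
  then show False
    using Orb_chain_neq assms Orb_eqI[OF assms(3,4)] by cases metis+
qed

lemma not_climbs_pos: "\<not> climbs k \<Longrightarrow> k > 0"
  using climbs_0 by (cases k) auto

lemma dead_unique:
  assumes "live i" "\<not> climbs i" "live j" "\<not> climbs j"
  shows "i = j"
  using assms unfolding live_def by (metis linorder_neqE_nat)

text \<open>All neighbours of such a \<open>chain i\<close> would lie in the orbit of
  \<open>chain k\<close>. For \<open>i = 0\<close> the neighbour \<open>a\<close> gives
  \<open>k = 0\<close>, where the chain does climb; otherwise the predecessor gives
  \<open>i = Suc k\<close>, which is not live.\<close>

lemma top_not_live:
  assumes k: "live k" "\<not> climbs k" "N (chain (Suc k)) \<subseteq> Orb (chain k)" and i: "live i"
  shows "chain (Suc k) \<notin> Orb (chain i)"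
proof
  assume "chain (Suc k) \<in> Orb (chain i)"
  then obtain \<psi> where \<psi>: "\<psi> \<in> Aut V E" "chain (Suc k) = \<psi> (chain i)" by (rule Orb_obtain)
  have sub: "y \<in> Orb (chain k)" if "y \<in> N (chain i)" for y
  proof -
    have "\<psi> y \<in> N (chain (Suc k))" using that Aut_neighbors[OF \<psi>(1), of "chain i"] \<psi>(2) by simp
    then show ?thesis using k(3) Orb_image_iff[OF \<psi>(1)] by blast
  qed
  show False
  proof (cases i)
    case 0
    then have "a \<in> Orb (chain k)" using sub v_edges by simp
    then have "k = 0" using chain_index_eq[OF k(1) live_0, of a] a_Orb by simp
    then show False using not_climbs_pos[OF k(2)] by simp
  next
    case (Suc m)
    then have "live m" using i by (simp add: live_Suc)
    then have "chain m \<in> N (chain i)" using chain_step(2)[of m] edge_sym[of "chain i"] Suc by simp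
    then have "m = k" using chain_index_eq[OF \<open>live m\<close> k(1)] sub Orb_self by blast
    then show False using i k(2) Suc by (simp add: live_Suc)
  qed
qed

text \<open>The top has a neighbour outside the orbit of \<open>chain k\<close>; a second one
  inside, besides \<open>chain k\<close>, would make the chain climb.\<close>

lemma two_distinguishable_good_arc:
  assumes k: "live k" "\<not> climbs k" and s: "chain (Suc k) \<notin> Orb (chain k)"
    "\<not> N (chain (Suc k)) \<subseteq> Orb (chain k)"
  shows "two_distinguishable V E"
proof -
  let ?s = "chain (Suc k)" and ?A = "N (chain (Suc k))" and ?O = "Orb (chain k)"
  obtain m where m: "k = Suc m" using not_climbs_pos[OF k(2)] by (cases k) auto
  have rin: "chain k \<in> ?A \<inter> ?O" using chain_step(2)[OF k(1)] edge_sym[of ?s] Orb_self by simp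
  have fin: "finite ?A" and c3: "card ?A \<le> 3"
    using chain_Suc_in[OF k(1)] finite_neighbors card_neighbors_le by auto
  have "card (?A \<inter> ?O) < card ?A"
    using s(2) fin by (intro psubset_card_mono) auto
  then have "card (?A \<inter> ?O) \<le> 1"
    using c3 k(2) unfolding climbs_def by linarith
  then have inn: "?A \<inter> ?O = {chain k}"
    using rin fin card_le_Suc0_iff_eq[of "?A \<inter> ?O"] by auto
  \<comment> \<open>Apart from the top, the neighbours of \<open>chain k\<close> lie in the
    preceding orbit.\<close>
  have "N (chain k) \<inter> ?O = {}"
  proof (rule ccontr)
    assume "N (chain k) \<inter> ?O \<noteq> {}"
    then obtain y where y: "y \<in> N (chain k)" "y \<in> ?O" by blast
    have "y \<noteq> ?s" using y(2) s(1) by blast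
    then have ym: "y \<in> Orb (chain m)" using chain_inner[of m y] k(1) y(1) unfolding m by simp
    have "live m" using k(1) unfolding m by (simp add: live_Suc)
    from chain_index_eq[OF this k(1) ym y(2)] have "m = k" .
    then show False using m by simp
  qed
  then show ?thesis
    using good_arc_two_distinguishable[of "chain k" ?s] chain_step[OF k(1)] inn by blast
qed

section \<open>The parent relation formed by all images of the chain\<close>

text \<open>Where the last edge can be reversed, its two ends are parents of each other, so the
  relation is functional but not always acyclic.\<close>

definition up :: "('a \<times> 'a) set" where
  "up = {(\<psi> (chain i), \<psi> (chain (Suc i))) |\<psi> i. \<psi> \<in> Aut V E \<and> live i}"

lemma up_I:
  assumes "live i" "x \<in> Orb (chain i)" "y \<in> Orb (chain (Suc i))" "(x, y) \<in> E"
  shows "(x, y) \<in> up"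
proof -
  obtain \<psi> where \<psi>: "\<psi> \<in> Aut V E" "x = \<psi> (chain i)" using Orb_obtain[OF assms(2)] .
  have "y \<in> N x \<inter> Orb (chain (Suc i))" using assms by simp
  then have "y = \<psi> (chain (Suc i))"
    using Aut_neighbors_Orb[OF \<psi>(1), of "chain i"] \<psi>(2) chain_step(3)[OF assms(1)] by simp
  then show ?thesis using \<psi> assms(1) unfolding up_def by blast
qed

lemma up_D:
  assumes "(x, y) \<in> up"
  obtains i where "live i" "x \<in> Orb (chain i)" "y \<in> Orb (chain (Suc i))" "(x, y) \<in> E"
proof -
  obtain \<psi> i where \<psi>: "\<psi> \<in> Aut V E" "live i" "x = \<psi> (chain i)" "y = \<psi> (chain (Suc i))"
    using assms unfolding up_def by blast
  then have "(x, y) \<in> E" using Aut_edge[OF \<psi>(1)] chain_step(2)[OF \<psi>(2)] by simp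
  then show ?thesis using that[OF \<psi>(2)] Orb_I[OF \<psi>(1)] \<psi>(3,4) by simp
qed

lemma up_functional:
  assumes "(x, y) \<in> up" "(x, y') \<in> up"
  shows "y = y'"
proof -
  obtain i where i: "live i" "x \<in> Orb (chain i)" "y \<in> Orb (chain (Suc i))" "(x, y) \<in> E"
    using up_D[OF assms(1)] .
  obtain j where j: "live j" "x \<in> Orb (chain j)" "y' \<in> Orb (chain (Suc j))" "(x, y') \<in> E"
    using up_D[OF assms(2)] .
  have "i = j" using chain_index_eq i j by blast
  obtain \<psi> where \<psi>: "\<psi> \<in> Aut V E" "x = \<psi> (chain i)" using Orb_obtain[OF i(2)] .
  have "N x \<inter> Orb (chain (Suc i)) = {\<psi> (chain (Suc i))}"
    using Aut_neighbors_Orb[OF \<psi>(1), of "chain i"] \<psi>(2) chain_step(3)[OF i(1)] by simp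
  moreover have "y \<in> N x \<inter> Orb (chain (Suc i))" "y' \<in> N x \<inter> Orb (chain (Suc i))"
    using i j \<open>i = j\<close> by auto
  ultimately show ?thesis by simp
qed

text \<open>Rules out the recognizable arc. An endless chain satisfies it vacuously.\<close>

definition closes :: bool where
  "closes \<longleftrightarrow> (\<forall>k. live k \<and> \<not> climbs k \<longrightarrow>
     N (chain (Suc k)) \<subseteq> Orb (chain k) \<or> chain (Suc k) \<in> Orb (chain k))"

text \<open>The cases are: sibling in a triangle, child, parent. An automorphism moves the question
  to the chain itself.\<close>

lemma neighbors_live:
  assumes "live i" "x \<in> Orb (chain i)" "(x, y) \<in> E"
  obtains "i = 0" "y \<in> Orb (chain 0)" "\<exists>z. (x, z) \<in> up \<and> (y, z) \<in> up"
  | j where "i = Suc j" "y \<in> Orb (chain j)" "(y, x) \<in> up"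
  | "y \<in> Orb (chain (Suc i))" "(x, y) \<in> up"
proof -
  obtain \<psi> where \<psi>: "\<psi> \<in> Aut V E" "x = \<psi> (chain i)" using Orb_obtain[OF assms(2)] .
  obtain y0 where y0: "y0 \<in> N (chain i)" "y = \<psi> y0"
    using Aut_neighbors_obtain[OF \<psi>(1)] assms(3) unfolding \<psi>(2) by metis
  show thesis
  proof (cases "y0 = chain (Suc i)")
    case True
    then have "y \<in> Orb (chain (Suc i))" using y0(2) Orb_I[OF \<psi>(1)] by simp
    then show ?thesis using that(3) up_I[OF assms(1,2) _ assms(3)] by blast
  next
    case False
    show ?thesis
    proof (cases i)
      case 0
      then have "y0 = a" using y0(1) N_v False by auto
      then have yO: "y \<in> Orb (chain 0)" using y0(2) Orb_image_iff[OF \<psi>(1)] a_Orb by simp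
      have bO: "\<psi> b \<in> Orb (chain (Suc 0))" using Orb_I[OF \<psi>(1)] by simp
      have "(x, \<psi> b) \<in> E" "(y, \<psi> b) \<in> E"
        using Aut_edge[OF \<psi>(1)] \<psi>(2) y0(2) \<open>y0 = a\<close> 0 v_edges a_edges by auto
      then have "(x, \<psi> b) \<in> up" "(y, \<psi> b) \<in> up"
        using up_I[OF live_0 _ bO] yO assms(2) 0 by auto
      then show ?thesis using that(1)[OF 0 yO] by blast
    next
      case (Suc j)
      then have "y0 \<in> Orb (chain j)" using chain_inner[of j y0] assms(1) y0(1) False by simp
      then have yO: "y \<in> Orb (chain j)" using y0(2) Orb_image_iff[OF \<psi>(1)] by simp
      have "(y, x) \<in> up"
        using up_I[of j y x] yO assms Suc edge_sym[of y x] by (simp add: live_Suc)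
      then show ?thesis using that(2)[OF Suc yO] by blast
    qed
  qed
qed

text \<open>The layers are closed under adjacency, because by \<open>closes\<close> the neighbours
  of a top vertex outside the live layers lie one layer lower.\<close>

lemma closes_cover:
  assumes closes "x \<in> V"
  shows "\<exists>i. live i \<and> (x \<in> Orb (chain i) \<or> x \<in> Orb (chain (Suc i)))"
proof -
  let ?W = "{x. \<exists>i. live i \<and> (x \<in> Orb (chain i) \<or> x \<in> Orb (chain (Suc i)))}"
  have "?W = V"
  proof (rule connected_closed)
    show "?W \<subseteq> V" using Orb_subset chain_step(1) chain_Suc_in by blast
    have "v \<in> ?W" using live_0 Orb_self[of v] by (intro CollectI exI[of _ 0]) simp
    then show "?W \<noteq> {}" by blast
    fix x y assume x: "x \<in> ?W" and e: "(x, y) \<in> E"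
    have liv: "y \<in> ?W" if "live i" "x \<in> Orb (chain i)" for i
      using neighbors_live[OF that e]
    proof cases
      case 1 then show ?thesis using that(1) by blast
    next
      case (2 j)
      then have "live j" using that(1) by (simp add: live_Suc)
      then show ?thesis using 2(2) by blast
    next
      case 3 then show ?thesis using that(1) by blast
    qed
    obtain i where i: "live i" "x \<in> Orb (chain i) \<or> x \<in> Orb (chain (Suc i))" using x by blast
    show "y \<in> ?W"
    proof (cases "x \<in> Orb (chain i)")
      case True then show ?thesis using liv i(1) by blast
    next
      case False
      then have xS: "x \<in> Orb (chain (Suc i))" using i(2) by blast
      show ?thesis
      proof (cases "live (Suc i)")
        case True then show ?thesis using liv xS by blast
      next
        case nl: False
        have "chain (Suc i) \<notin> Orb (chain i)" using False xS Orb_eq by metis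
        moreover have "\<not> climbs i" using nl i(1) by (simp add: live_Suc)
        ultimately have sub: "N (chain (Suc i)) \<subseteq> Orb (chain i)"
          using assms(1) i(1) unfolding closes_def by blast
        obtain \<psi> where \<psi>: "\<psi> \<in> Aut V E" "x = \<psi> (chain (Suc i))" using Orb_obtain[OF xS] .
        obtain y0 where "y0 \<in> N (chain (Suc i))" "y = \<psi> y0"
          using Aut_neighbors_obtain[OF \<psi>(1)] e unfolding \<psi>(2) by metis
        then have "y \<in> Orb (chain i)" using sub Orb_image_iff[OF \<psi>(1)] by blast
        then show ?thesis using i(1) by blast
      qed
    qed
  qed
  then show ?thesis using assms(2) by blast
qed

lemma closes_edge:
  assumes closes "(x, y) \<in> E"
  shows "(x, y) \<in> up \<or> (y, x) \<in> up \<or>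
    x \<in> Orb v \<and> y \<in> Orb v \<and> (\<exists>z. (x, z) \<in> up \<and> (y, z) \<in> up)"
proof -
  have liv: ?thesis if "live i" "x \<in> Orb (chain i)" for i
    using neighbors_live[OF that assms(2)] that(2) by cases auto
  obtain i where i: "live i" "x \<in> Orb (chain i) \<or> x \<in> Orb (chain (Suc i))"
    using closes_cover[OF assms(1)] edge_in(1)[OF assms(2)] by blast
  show ?thesis
  proof (cases "x \<in> Orb (chain i)")
    case True then show ?thesis using liv i(1) by blast
  next
    case False
    then have xS: "x \<in> Orb (chain (Suc i))" using i(2) by blast
    show ?thesis
    proof (cases "live (Suc i)")
      case True then show ?thesis using liv xS by blast
    next
      case nl: False
      have "chain (Suc i) \<notin> Orb (chain i)" using False xS Orb_eq by metis
      moreover have "\<not> climbs i" using nl i(1) by (simp add: live_Suc)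
      ultimately have sub: "N (chain (Suc i)) \<subseteq> Orb (chain i)"
        using assms(1) i(1) unfolding closes_def by blast
      obtain \<psi> where \<psi>: "\<psi> \<in> Aut V E" "x = \<psi> (chain (Suc i))" using Orb_obtain[OF xS] .
      obtain y0 where "y0 \<in> N (chain (Suc i))" "y = \<psi> y0"
        using Aut_neighbors_obtain[OF \<psi>(1)] assms(2) unfolding \<psi>(2) by metis
      then have "y \<in> Orb (chain i)" using sub Orb_image_iff[OF \<psi>(1)] by blast
      then have "(y, x) \<in> up" using up_I[OF i(1) _ xS] assms(2) edge_sym[of y x] by simp
      then show ?thesis by blast
    qed
  qed
qed

text \<open>Induction along a path. A step down keeps the ancestor. A step up keeps it because
  \<open>up\<close> is functional, unless the current vertex is the ancestor, which is then replaced
  by its parent. A sibling shares the parent.\<close>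

lemma common_ancestor:
  assumes closes "x \<in> V" "y \<in> V"
  shows "\<exists>z. (x, z) \<in> up\<^sup>* \<and> (y, z) \<in> up\<^sup>*"
proof -
  have "(x, y) \<in> E\<^sup>*" using connected assms by (simp add: connected_graph_def)
  then show ?thesis
  proof (induction rule: rtrancl_induct)
    case base then show ?case by blast
  next
    case (step y y')
    then obtain z where z: "(x, z) \<in> up\<^sup>*" "(y, z) \<in> up\<^sup>*" by blast
    have lift: "\<exists>z. (x, z) \<in> up\<^sup>* \<and> (t, z) \<in> up\<^sup>*" if "(y, t) \<in> up" for t
    proof (cases "y = z")
      case True then show ?thesis using z(1) that by (meson rtrancl.rtrancl_into_rtrancl rtrancl.rtrancl_refl)
    next
      case False
      then obtain t' where "(y, t') \<in> up" "(t', z) \<in> up\<^sup>*" using z(2) by (meson converse_rtranclE)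
      then show ?thesis using up_functional[OF that] z(1) by blast
    qed
    from closes_edge[OF assms(1) step(2)] show ?case
    proof (elim disjE exE conjE)
      assume "(y, y') \<in> up" then show ?thesis by (rule lift)
    next
      assume "(y', y) \<in> up" then show ?thesis using z by (meson converse_rtrancl_into_rtrancl)
    next
      fix t assume "(y, t) \<in> up" "(y', t) \<in> up"
      then show ?thesis using lift by (meson converse_rtrancl_into_rtrancl)
    qed
  qed
qed

text \<open>With truncated subtraction, \<open>live (j - 1)\<close> admits \<open>j = 0\<close> and
  also the index just after the last live one. A step from there exists only if the last edge can be
  reversed, and it leads back to the image of \<open>chain k\<close>.\<close>

lemma up_rtrancl_chain:
  assumes closes and \<phi>: "\<phi> \<in> Aut V E" and "(\<phi> v, z) \<in> up\<^sup>*"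
  shows "\<exists>j. live (j - 1) \<and> z = \<phi> (chain j)"
  using assms(3)
proof (induction rule: rtrancl_induct)
  case base
  then show ?case using live_0 by (intro exI[of _ 0]) simp
next
  case (step z z')
  then obtain j where j: "live (j - 1)" "z = \<phi> (chain j)" by blast
  have next_live: "(\<phi> (chain i), \<phi> (chain (Suc i))) \<in> up" if "live i" for i
    using \<phi> that unfolding up_def by blast
  show ?case
  proof (cases "live j")
    case True
    then have "z' = \<phi> (chain (Suc j))" using up_functional[OF step(2)] next_live j(2) by simp
    then show ?thesis using True by (intro exI[of _ "Suc j"]) simp
  next
    case False
    then obtain k where k: "j = Suc k" using live_0 by (cases j) auto
    have lk: "live k" "\<not> climbs k" using j(1) False k by (simp_all add: live_Suc)
    obtain i where i: "live i" "z \<in> Orb (chain i)" using up_D[OF step(2)] .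
    have "chain (Suc k) \<in> Orb (chain i)" using i(2) j(2) k Orb_image_iff[OF \<phi>] by simp
    then have "\<not> N (chain (Suc k)) \<subseteq> Orb (chain k)" using top_not_live[OF lk _ i(1)] by blast
    then have sk: "chain (Suc k) \<in> Orb (chain k)" using assms(1) lk unfolding closes_def by blast
    have ke: "(chain (Suc k), chain k) \<in> E" using chain_step(2)[OF lk(1)] edge_sym by blast
    have "\<phi> (chain k) \<in> Orb (chain (Suc k))"
      using Orb_eq[OF sk] Orb_I[OF \<phi>, of "chain k"] by simp
    moreover have "\<phi> (chain (Suc k)) \<in> Orb (chain k)" using sk Orb_image_iff[OF \<phi>] by simp
    ultimately have "(z, \<phi> (chain k)) \<in> up"
      using up_I[OF lk(1)] ke Aut_edge[OF \<phi>] j(2) k by simp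
    then have "z' = \<phi> (chain k)" using up_functional[OF step(2)] by blast
    then show ?thesis using lk(1) live_mono[of k "k - 1"] by (intro exI[of _ k]) simp
  qed
qed

section \<open>Colouring along the chain when it is endless or ends without a threefold top\<close>

text \<open>A common ancestor of \<open>v\<close> and its image gives a member of the chain that a
  colour-preserving automorphism fixes. White siblings then carry the fixing down to
  \<open>v\<close>.\<close>

lemma two_distinguishable_closes:
  assumes top: "\<And>k. live k \<Longrightarrow> \<not> climbs k \<Longrightarrow> chain (Suc k) \<in> Orb (chain k) \<or>
    N (chain (Suc k)) \<subseteq> Orb (chain k) \<and> card (N (chain (Suc k))) \<le> 2"
  shows "two_distinguishable V E"
proof -
  have closes: closes using top unfolding closes_def by blast
  let ?H = "{\<phi> \<in> Aut V E. \<phi> v = v}"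
  \<comment> \<open>The last vertex of the chain stays white: it is in the orbit of its predecessor if the chain ends
    in an edge that some automorphism reverses.\<close>
  define black where "black = {x. \<exists>j. live j \<and> x = chain j}"
  define F0 where "F0 = {x. \<exists>j. live (j - 1) \<and> x = chain j}"
  let ?S0 = "{(x, x \<in> black) |x. x \<in> F0}"
  \<comment> \<open>As singletons, the siblings of the members of the chain are forbidden to be
    black.\<close>
  let ?\<B> = "{{x} |x i. live i \<and> x \<in> N (chain (Suc i)) \<and> x \<in> Orb (chain i) \<and> x \<noteq> chain i}"
  have DomS0: "Domain ?S0 = F0" by auto
  have live_pred: "live (j - 1)" if "live j" for j using live_mono[OF that] by simp
  have F0_live: "chain i \<in> F0" "chain (Suc i) \<in> F0" if "live i" for i
  proof -
    show "chain i \<in> F0" using live_pred[OF that] unfolding F0_def by blast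
    show "chain (Suc i) \<in> F0" using that unfolding F0_def by (intro CollectI exI[of _ "Suc i"]) simp
  qed
  have black_iff: "chain j \<in> black \<longleftrightarrow> live j" if j: "live (j - 1)" for j
  proof
    assume "live j" then show "chain j \<in> black" unfolding black_def by blast
  next
    assume "chain j \<in> black"
    then obtain i where i: "live i" "chain j = chain i" unfolding black_def by blast
    show "live j"
    proof (rule ccontr)
      assume nl: "\<not> live j"
      then obtain k where k: "j = Suc k" using live_0 by (cases j) auto
      have lk: "live k" "\<not> climbs k" using j nl k by (simp_all add: live_Suc)
      have "chain (Suc k) \<in> Orb (chain i)" using i(2) k Orb_self by simp
      then have "chain (Suc k) \<in> Orb (chain k)" using top[OF lk] top_not_live[OF lk _ i(1)] by blast
      then have "i = k" using chain_index_eq[OF i(1) lk(1)] \<open>chain (Suc k) \<in> Orb (chain i)\<close> by blast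
      then show False using chain_step(2)[OF lk(1)] i(2) k by simp
    qed
  qed
  have fix_chain: "\<phi> (chain j) = chain j" if "\<phi> \<in> ?H" "live (j - 1)" for \<phi> j
    using that(2)
  proof (induction j)
    case 0 then show ?case using that(1) by simp
  next
    case (Suc i)
    then have li: "live i" by simp
    have A: "\<phi> \<in> Aut V E" using that(1) by simp
    have fi: "\<phi> (chain i) = chain i" using Suc.IH live_pred[OF li] by simp
    have "(chain i, \<phi> (chain (Suc i))) \<in> E"
      using Aut_edge[OF A, of "chain i" "chain (Suc i)"] fi chain_step(2)[OF li] by simp
    then have "\<phi> (chain (Suc i)) \<in> N (chain i) \<inter> Orb (chain (Suc i))"
      using Orb_I[OF A, of "chain (Suc i)"] by simp
    then show ?case unfolding chain_step(3)[OF li] by simp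
  qed
  \<comment> \<open>An uncoloured sibling \<open>w\<close> would have an uncoloured partner below
    the same parent, next to \<open>chain i\<close>. If the chain goes on, its next member is a
    fourth neighbour. At the top, valence 3 leaves the reversible edge, where the parent has only
    one neighbour in the orbit of \<open>chain i\<close>.\<close>
  have not_bad: "{w} \<notin> ?\<B>"
    if sub: "?S0 \<subseteq> S" and V: "Domain S \<subseteq> V" and st: "stalled (Domain S)" and wF: "w \<notin> Domain S" for S w
  proof
    assume "{w} \<in> ?\<B>"
    then obtain i where i: "live i" "w \<in> N (chain (Suc i))" "w \<in> Orb (chain i)" "w \<noteq> chain i" by auto
    let ?q = "chain (Suc i)"
    have F0S: "F0 \<subseteq> Domain S" using Domain_mono[OF sub] DomS0 by simp
    have q: "?q \<in> Domain S" "chain i \<in> Domain S" using F0_live[OF i(1)] F0S by auto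
    have "w \<in> N ?q - Domain S" using i(2) wF by simp
    then obtain y where y: "twin (Domain S) ?q w y" using stalled_twin[OF st q(1)] by blast
    have yN: "y \<in> N ?q" "y \<notin> Domain S" "y \<noteq> w" using y unfolding twin_def by auto
    have iN: "chain i \<in> N ?q" using chain_step(2)[OF i(1)] edge_sym[of ?q] by simp
    have fin: "finite (N ?q)" using finite_neighbors chain_Suc_in[OF i(1)] by blast
    have three: "{chain i, w, y} \<subseteq> N ?q" "card {chain i, w, y} = 3"
    proof -
      have "chain i \<noteq> y" using q(2) yN(2) by blast
      then show "card {chain i, w, y} = 3" using i(4) yN(3) by simp
      show "{chain i, w, y} \<subseteq> N ?q" using iN i(2) yN(1) by blast
    qed
    show False
    proof (cases "climbs i")
      case True
      then have ls: "live (Suc i)" using i(1) by (simp add: live_Suc)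
      let ?z = "chain (Suc (Suc i))"
      have zD: "?z \<in> Domain S" using F0_live(2)[OF ls] F0S by blast
      have zN: "?z \<in> N ?q" "?z \<notin> Orb (chain i)" using chain_outer[OF ls] by blast+
      have "?z \<noteq> w" "?z \<noteq> y" "?z \<noteq> chain i" using zD zN(2) wF yN(2) Orb_self[of "chain i"] by auto
      then have "card (insert ?z {chain i, w, y}) = 4" using three(2) by simp
      moreover have "card (insert ?z {chain i, w, y}) \<le> card (N ?q)"
        using three(1) zN(1) by (intro card_mono[OF fin]) auto
      ultimately show False using card_neighbors_le chain_Suc_in[OF i(1)] by fastforce
    next
      case False
      have "3 \<le> card (N ?q)" using card_mono[OF fin three(1)] three(2) by simp
      then have sk: "?q \<in> Orb (chain i)" using top[OF i(1) False] by auto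
      have "card (N ?q \<inter> Orb (chain i)) = card (N (chain i) \<inter> Orb ?q)"
        using card_neighbors_Orb(2)[OF sk] Orb_eq[OF sk] by simp
      then have c1: "card (N ?q \<inter> Orb (chain i)) = 1" using chain_step(3)[OF i(1)] by simp
      have "{chain i, w} \<subseteq> N ?q \<inter> Orb (chain i)" using iN i(2,3) Orb_self by auto
      then have "card {chain i, w} \<le> 1" using c1 card_mono[of "N ?q \<inter> Orb (chain i)"] fin by (metis finite_Int)
      then show False using i(4) by simp
    qed
  qed
  obtain B where B: "\<And>x b. (x, b) \<in> ?S0 \<Longrightarrow> (x \<in> B) = b" "\<And>X. X \<in> ?\<B> \<Longrightarrow> \<not> X \<subseteq> B"
    "\<And>\<phi>. \<phi> \<in> ?H \<Longrightarrow> \<forall>x\<in>V. \<phi> x \<in> B \<longleftrightarrow> x \<in> B \<Longrightarrow> \<phi> = id"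
  proof (rule greedy_coloring[of ?S0 ?H ?\<B>])
    show "single_valued ?S0" by (auto simp: single_valued_def)
    show "Domain ?S0 \<subseteq> V"
    proof -
      have "chain j \<in> V" if "live (j - 1)" for j
        using that live_0 chain_step(1)[of 0] chain_Suc_in by (cases j) auto
      then show ?thesis unfolding DomS0 F0_def by blast
    qed
    show "?S0 \<noteq> {}" using F0_live(1)[OF live_0] by blast
    show "N x \<inter> Domain ?S0 \<noteq> {}" if x: "x \<in> Domain ?S0" for x
    proof -
      obtain j where j: "live (j - 1)" "x = chain j" using x unfolding DomS0 F0_def by blast
      show ?thesis
      proof (cases j)
        case 0
        have "chain 1 \<in> N x" using j(2) 0 chain_step(2)[OF live_0] by simp
        then show ?thesis using F0_live(2)[OF live_0] unfolding DomS0 by auto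
      next
        case (Suc i)
        then have li: "live i" using j by simp
        have "chain i \<in> N x" using j(2) Suc chain_step(2)[OF li] edge_sym[of x] by simp
        then show ?thesis using F0_live(1)[OF li] unfolding DomS0 by blast
      qed
    qed
    show "\<phi> x = x" if "\<phi> \<in> ?H" "x \<in> Domain ?S0" for \<phi> x
      using that(2) fix_chain[OF that(1)] unfolding DomS0 F0_def by blast
    show "\<not> X \<times> {True} \<subseteq> ?S0" if X: "X \<in> ?\<B>" for X
    proof
      assume sub: "X \<times> {True} \<subseteq> ?S0"
      obtain x i where x: "X = {x}" "live i" "x \<in> Orb (chain i)" "x \<noteq> chain i" using X by blast
      have "x \<in> black" using sub x(1) by auto
      then obtain j where j: "live j" "x = chain j" unfolding black_def by blast
      then have "i = j" using chain_index_eq[OF x(2) j(1) x(3)] Orb_self by simp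
      then show False using x(4) j(2) by simp
    qed
    show "\<exists>p w w'. twin (Domain S) p w w' \<and> (\<forall>X\<in>?\<B>. w \<in> X \<longrightarrow> \<not> (X - {w}) \<times> {True} \<subseteq> S)"
      if S: "?S0 \<subseteq> S" "Domain S \<subseteq> V" "stalled (Domain S)" and tw: "twin (Domain S) p w w'" for S p w w'
    proof (intro exI conjI ballI impI)
      show "twin (Domain S) p w w'" by (rule tw)
      have wF: "w \<notin> Domain S" using tw unfolding twin_def by blast
      fix X assume X: "X \<in> ?\<B>" "w \<in> X"
      then have "X = {w}" by auto
      then show "\<not> (X - {w}) \<times> {True} \<subseteq> S" using X(1) not_bad[OF S wF] by simp
    qed
  qed auto
  have F0_B: "chain j \<in> B \<longleftrightarrow> live j" if "live (j - 1)" for j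
  proof -
    have "chain j \<in> F0" using that unfolding F0_def by blast
    then have "(chain j, chain j \<in> black) \<in> ?S0" by blast
    then show ?thesis using B(1) black_iff[OF that] by blast
  qed
  have "\<phi> = id" if \<phi>: "\<phi> \<in> Aut V E" and pres: "\<forall>x\<in>V. \<phi> x \<in> B \<longleftrightarrow> x \<in> B" for \<phi>
  proof -
    have chainV: "chain j \<in> V" if "live (j - 1)" for j
      using that live_0 chain_step(1)[of 0] chain_Suc_in by (cases j) auto
    have \<phi>v: "\<phi> v \<in> V" using Aut_in[OF \<phi>] v_in by simp
    obtain z where z: "(v, z) \<in> up\<^sup>*" "(\<phi> v, z) \<in> up\<^sup>*"
      using common_ancestor[OF closes v_in \<phi>v] by blast
    obtain i where i: "live (i - 1)" "z = chain i"
      using up_rtrancl_chain[OF closes Aut_id] z(1) by auto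
    obtain j where j: "live (j - 1)" "z = \<phi> (chain j)"
      using up_rtrancl_chain[OF closes \<phi> z(2)] by blast
    have ij: "chain i = \<phi> (chain j)" using i j by simp
    \<comment> \<open>The colour of the common ancestor tells whether its index is live. Live
      indices are told apart by their orbits, and there is at most one index just after the last
      live one.\<close>
    have "live i \<longleftrightarrow> live j"
      using F0_B[OF i(1)] F0_B[OF j(1)] pres chainV[OF j(1)] ij by simp
    moreover have "i = j" if "live i" "live j"
    proof -
      have "chain i \<in> Orb (chain j)" using ij Orb_I[OF \<phi>] by simp
      then show ?thesis using chain_index_eq[OF that Orb_self] by simp
    qed
    moreover have "i = j" if nl: "\<not> live i" "\<not> live j"
    proof -
      obtain k where k: "i = Suc k" using nl(1) live_0 by (cases i) auto
      obtain l where l: "j = Suc l" using nl(2) live_0 by (cases j) auto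
      show ?thesis using dead_unique[of k l] i(1) j(1) nl k l by (simp add: live_Suc)
    qed
    ultimately have "i = j" by blast
    then have "\<phi> (chain i) = chain i" using ij by simp
    \<comment> \<open>Descent: the image of \<open>chain m\<close> is a black neighbour of the fixed
      \<open>chain (Suc m)\<close> in the orbit of \<open>chain m\<close>, hence not a
      sibling.\<close>
    then have "\<phi> v = v" using i(1)
    proof (induction i)
      case 0 then show ?case by simp
    next
      case (Suc m)
      then have lm: "live m" by simp
      have "(chain (Suc m), \<phi> (chain m)) \<in> E"
        using Aut_edge[OF \<phi>, of "chain (Suc m)" "chain m"] Suc.prems(1) chain_step(2)[OF lm]
          edge_sym[of "chain m"] by simp
      then have nb: "\<phi> (chain m) \<in> N (chain (Suc m))" by simp
      have "chain m \<in> B" using F0_B[of m] live_pred[OF lm] lm by simp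
      then have "\<phi> (chain m) \<in> B" using pres chain_step(1)[OF lm] by simp
      then have "{\<phi> (chain m)} \<notin> ?\<B>" using B(2) by blast
      then have "\<phi> (chain m) = chain m" using lm nb Orb_I[OF \<phi>, of "chain m"] by blast
      then show ?case using Suc.IH live_pred[OF lm] by simp
    qed
    then show ?thesis using B(3) \<phi> pres by blast
  qed
  then show ?thesis unfolding two_distinguishable_def by blast
qed

section \<open>Recognizing \<open>S_n\<close>\<close>

text \<open>Dropping the edges inside the orbit of \<open>v\<close> leaves the parent edges, which
  form a tree rooted at the top; \<open>card_top\<close> gives the root its valence 3.\<close>

lemma is_S_closes:
  assumes k: "live k" "\<not> climbs k" and sub: "N (chain (Suc k)) \<subseteq> Orb (chain k)"
    and card_top: "card (N (chain (Suc k))) = 3"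
  shows "is_S (Suc k) V E"
proof -
  let ?s = "chain (Suc k)"
  have closes: closes
    unfolding closes_def using dead_unique[OF k] sub by blast
  have live_iff: "live i \<longleftrightarrow> i \<le> k" for i
  proof
    assume "live i"
    show "i \<le> k"
    proof (rule ccontr)
      assume "\<not> i \<le> k"
      then have "live (Suc k)" using live_mono[OF \<open>live i\<close>] by simp
      then show False using k(2) by (simp add: live_Suc)
    qed
  qed (use live_mono[OF k(1)] in simp)
  have s_in: "?s \<in> V" using chain_Suc_in[OF k(1)] .
  have s_fresh: False if "i \<le> k" "x \<in> Orb (chain i)" "x \<in> Orb ?s" for i x
  proof -
    have "?s \<in> Orb (chain i)" using Orb_eqI[OF that(2,3)] Orb_self[of ?s] by simp
    then show False using top_not_live[OF k sub] that(1) live_iff by blast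
  qed
  have layer_unique: "i = j"
    if ij: "i \<le> Suc k" "j \<le> Suc k" "x \<in> Orb (chain i)" "x \<in> Orb (chain j)" for i j x
  proof -
    consider "i \<le> k" "j \<le> k" | "i \<le> k" "j = Suc k" | "i = Suc k" "j \<le> k" | "i = Suc k" "j = Suc k"
      using ij(1,2) by linarith
    then show ?thesis
    proof cases
      case 1 then show ?thesis using chain_index_eq[OF _ _ ij(3,4)] live_iff by blast
    next
      case 2 then show ?thesis using s_fresh[OF _ ij(3)] ij(4) by blast
    next
      case 3 then show ?thesis using s_fresh[OF _ ij(4)] ij(3) by blast
    qed simp
  qed
  \<comment> \<open>The height above the leaves, read off from the orbit.\<close>
  define ly where "ly x = (THE i. i \<le> Suc k \<and> x \<in> Orb (chain i))" for x
  have ly_eq: "ly x = i" if "i \<le> Suc k" "x \<in> Orb (chain i)" for x i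
    unfolding ly_def by (rule the_equality) (use that layer_unique in blast)+
  have ly: "ly x \<le> Suc k" "x \<in> Orb (chain (ly x))" if x: "x \<in> V" for x
  proof -
    obtain i where "live i" "x \<in> Orb (chain i) \<or> x \<in> Orb (chain (Suc i))"
      using closes_cover[OF closes x] by blast
    then have "\<exists>i\<le>Suc k. x \<in> Orb (chain i)" using live_iff by (metis Suc_le_mono le_SucI)
    then show "ly x \<le> Suc k" "x \<in> Orb (chain (ly x))" using ly_eq by blast+
  qed
  have up_ly: "ly x \<le> k" "ly y = Suc (ly x)" "(x, y) \<in> E" if xy: "(x, y) \<in> up" for x y
  proof -
    obtain i where i: "live i" "x \<in> Orb (chain i)" "y \<in> Orb (chain (Suc i))" "(x, y) \<in> E"
      using up_D[OF xy] .
    then have ik: "i \<le> k" using live_iff by blast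
    then have "ly x = i" "ly y = Suc i" using ly_eq i(2,3) by simp_all
    then show "ly x \<le> k" "ly y = Suc (ly x)" "(x, y) \<in> E" using ik i(4) by simp_all
  qed
  have ly_s: "ly ?s = Suc k" using ly_eq[of "Suc k" ?s] Orb_self[of ?s] by simp
  have s_top: "(?s, y) \<notin> up" for y using up_ly(1)[of ?s y] ly_s by auto
  \<comment> \<open>The top has no parent, so a common ancestor with it can only be the top.\<close>
  have reach: "(x, ?s) \<in> up\<^sup>*" if x: "x \<in> V" for x
  proof -
    obtain z where z: "(x, z) \<in> up\<^sup>*" "(?s, z) \<in> up\<^sup>*" using common_ancestor[OF closes x s_in] by blast
    from z(2) have "z = ?s" by (cases rule: converse_rtranclE) (use s_top in auto)
    then show ?thesis using z(1) by simp
  qed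
  have relpow_ly: "ly y = ly x + n" if "(x, y) \<in> up ^^ n" for x y n
    using that by (induction n arbitrary: y) (auto dest: up_ly(2))
  define ET where "ET = up \<union> up\<inverse>"
  have ET_iff: "(x, y) \<in> ET \<longleftrightarrow> (x, y) \<in> up \<or> (y, x) \<in> up" for x y unfolding ET_def by auto
  have ET_sym: "(x, y) \<in> ET \<longleftrightarrow> (y, x) \<in> ET" for x y unfolding ET_iff by blast
  have ET_E: "(x, y) \<in> E" if "(x, y) \<in> ET" for x y
    using that up_ly(3) edge_sym unfolding ET_iff by blast
  have ET_ly: "ly x \<le> Suc (ly y)" "ly x \<noteq> ly y" if "(x, y) \<in> ET" for x y
    using that up_ly(2)[of x y] up_ly(2)[of y x] unfolding ET_iff by auto
  have E_cases: "(x, y) \<in> ET \<or> x \<in> Orb v \<and> y \<in> Orb v \<and> (\<exists>z. (x, z) \<in> up \<and> (y, z) \<in> up)"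
    if "(x, y) \<in> E" for x y
    using closes_edge[OF closes that] unfolding ET_iff by blast
  have ly_0: "ly x = 0 \<longleftrightarrow> x \<in> Orb v" if "x \<in> V" for x
    using ly(2)[OF that] ly_eq[of 0 x] by auto
  have rev: "(y, x) \<in> ET ^^ n" if "(x, y) \<in> up ^^ n" for x y n
    using that
  proof (induction n arbitrary: y)
    case (Suc n)
    then obtain z where z: "(x, z) \<in> up ^^ n" "(z, y) \<in> up" by auto
    then have "(y, z) \<in> ET" unfolding ET_iff by simp
    then show ?case using Suc.IH[OF z(1)] by (rule relpow_Suc_I2)
  qed simp
  have simpleT: "simple_graph V ET"
    unfolding simple_graph_def
  proof (intro conjI)
    have "ET \<subseteq> E" using ET_E by auto
    then show "ET \<subseteq> V \<times> V" using simple unfolding simple_graph_def by blast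
    show "sym ET" using ET_sym by (auto intro: symI)
    show "irrefl ET" using ET_ly(2) by (auto intro!: irreflI)
  qed
  have connT: "connected_graph V ET"
    unfolding connected_graph_def
  proof (intro conjI ballI)
    show "V \<noteq> {}" using v_in by blast
    fix x y assume xy: "x \<in> V" "y \<in> V"
    have "up\<^sup>* \<subseteq> ET\<^sup>*" unfolding ET_def by (rule rtrancl_mono) simp
    then have "(x, ?s) \<in> ET\<^sup>*" "(y, ?s) \<in> ET\<^sup>*" using reach xy by auto
    moreover have "sym (ET\<^sup>*)" using simpleT by (simp add: simple_graph_def sym_rtrancl)
    ultimately show "(x, y) \<in> ET\<^sup>*" by (meson rtrancl_trans symD)
  qed
  \<comment> \<open>A vertex of least height on a cycle would have two different parents.\<close>
  have acyclic: "\<not> graph_cycle ET xs" for xs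
  proof
    assume "graph_cycle ET xs"
    let ?n = "length xs"
    have n: "?n \<ge> 3" "distinct xs" and e: "\<And>i. i < ?n \<Longrightarrow> (xs ! i, xs ! (Suc i mod ?n)) \<in> ET"
      using \<open>graph_cycle ET xs\<close> unfolding graph_cycle_def by auto
    have "0 < ?n" using n(1) by linarith
    then obtain i where i: "i < ?n" "\<And>j. j < ?n \<Longrightarrow> ly (xs ! i) \<le> ly (xs ! j)"
      using ex_has_least_nat[of "\<lambda>i. i < ?n" 0 "\<lambda>i. ly (xs ! i)"] by blast
    \<comment> \<open>The cyclic predecessor of \<open>i\<close>; it differs from the successor
      because the length is at least 3.\<close>
    define j where "j = (if i = 0 then ?n - 1 else i - 1)"
    have j: "j < ?n" "Suc j mod ?n = i" using i(1) unfolding j_def by auto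
    have m: "Suc i mod ?n < ?n" by (rule mod_less_divisor) (use i(1) in linarith)
    have neq: "j \<noteq> Suc i mod ?n"
      using i(1) n(1) unfolding j_def by (auto simp: mod_Suc)
    have up_of: "(xs ! i, y) \<in> up" if "(xs ! i, y) \<in> ET" "ly (xs ! i) \<le> ly y" for y
      using that up_ly(2)[of y "xs ! i"] unfolding ET_iff by auto
    have "(xs ! i, xs ! (Suc i mod ?n)) \<in> up" using up_of e[OF i(1)] i(2)[OF m] by blast
    moreover have "(xs ! i, xs ! j) \<in> up" using up_of e[OF j(1)] i(2)[OF j(1)] j(2) ET_sym by simp
    ultimately have "xs ! j = xs ! (Suc i mod ?n)" using up_functional by blast
    then show False using neq n(2) j(1) m by (simp add: nth_eq_iff_index_eq)
  qed
  have leaf_nb: "\<exists>z. neighbors ET x = {z}" if x: "x \<in> Orb v" for x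
  proof -
    have xV: "x \<in> V" using x Orb_subset[OF v_in] by blast
    have l0: "ly x = 0" using ly_0[OF xV] x by simp
    then have "x \<noteq> ?s" using ly_s by auto
    then obtain z where z: "(x, z) \<in> up" using reach[OF xV] by (meson converse_rtranclE)
    have "(x, y) \<in> ET \<longleftrightarrow> y = z" for y
    proof
      assume "(x, y) \<in> ET"
      moreover have "(y, x) \<notin> up" using up_ly(2)[of y x] l0 by (metis nat.distinct(1))
      ultimately have "(x, y) \<in> up" unfolding ET_iff by blast
      then show "y = z" using up_functional[OF _ z] by blast
    next
      assume "y = z"
      then show "(x, y) \<in> ET" using z unfolding ET_iff by simp
    qed
    then have "neighbors ET x = {z}" unfolding neighbors_def by simp
    then show ?thesis by blast
  qed
  have inner_nb: "neighbors ET x = N x \<and> card (N x) = 3" if x: "x \<in> V" "x \<notin> Orb v" for x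
  proof
    show "neighbors ET x = N x" using ET_E E_cases[of x] x(2) by auto
    have lx: "ly x \<noteq> 0" using ly_0 x by blast
    have "card (N (chain (ly x))) = 3"
    proof (cases "ly x = Suc k")
      case True then show ?thesis using card_top by simp
    next
      case False
      then obtain m where m: "ly x = Suc m" "Suc m \<le> k" using lx ly(1)[OF x(1)] by (cases "ly x") auto
      then show ?thesis using card_N_chain(1)[of m] live_iff by simp
    qed
    then show "card (N x) = 3" using card_neighbors_Orb(1)[OF ly(2)[OF x(1)]] by simp
  qed
  have val: "valence ET x = (if x \<in> Orb v then 1 else 3)" if x: "x \<in> V" for x
  proof (cases "x \<in> Orb v")
    case True
    then show ?thesis using leaf_nb[OF True] by (auto simp: valence_def one_enat_def)
  next
    case False
    then show ?thesis using inner_nb[OF x False] finite_neighbors[OF x]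
      by (simp add: valence_def numeral_eq_enat)
  qed
  have leaves_eq: "leaves V ET = Orb v"
  proof -
    have "(3 :: enat) \<noteq> 1" by simp
    then have "valence ET x = 1 \<longleftrightarrow> x \<in> Orb v" if "x \<in> V" for x
      unfolding val[OF that] by (cases "x \<in> Orb v") simp_all
    then show ?thesis unfolding leaves_def using Orb_subset[OF v_in] by blast
  qed
  have finV: "finite V"
  proof -
    have fin: "finite {x. (x, ?s) \<in> up ^^ n}" for n
    proof (induction n)
      case (Suc n)
      have "{x. (x, ?s) \<in> up ^^ Suc n} \<subseteq> (\<Union>y\<in>{x. (x, ?s) \<in> up ^^ n}. N y)"
      proof
        fix x assume "x \<in> {x. (x, ?s) \<in> up ^^ Suc n}"
        then obtain y where "(x, y) \<in> up" "(y, ?s) \<in> up ^^ n" using relpow_Suc_D2 by fastforce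
        then show "x \<in> (\<Union>y\<in>{x. (x, ?s) \<in> up ^^ n}. N y)" using up_ly(3) edge_sym by auto
      qed
      moreover have "finite (N y)" for y
      proof (cases "y \<in> V")
        case False
        then have "N y = {}" using edge_in(1)[of y] by auto
        then show ?thesis by simp
      qed (rule finite_neighbors)
      ultimately show ?case using Suc finite_subset by blast
    qed simp
    have "V \<subseteq> (\<Union>n\<le>Suc k. {x. (x, ?s) \<in> up ^^ n})"
    proof
      fix x assume "x \<in> V"
      then obtain n where n: "(x, ?s) \<in> up ^^ n" using reach rtrancl_imp_relpow by blast
      then have "n \<le> Suc k" using relpow_ly[OF n] ly_s by simp
      then show "x \<in> (\<Union>n\<le>Suc k. {x. (x, ?s) \<in> up ^^ n})" using n by blast
    qed
    then show ?thesis using fin finite_subset by blast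
  qed
  \<comment> \<open>The parent path has length \<open>Suc k\<close>, and along any path the height
    drops by at most one per edge.\<close>
  have dist: "graph_dist ET ?s x = Suc k" if x: "x \<in> leaves V ET" for x
    unfolding graph_dist_def
  proof (rule Least_equality)
    have xV: "x \<in> V" and lx: "ly x = 0"
      using x ly_0 Orb_subset[OF v_in] unfolding leaves_eq by auto
    obtain n where n: "(x, ?s) \<in> up ^^ n" using reach[OF xV] rtrancl_imp_relpow by blast
    then have "n = Suc k" using relpow_ly[OF n] ly_s lx by simp
    then show "(?s, x) \<in> ET ^^ Suc k" using rev[OF n] by simp
    fix m assume "(?s, x) \<in> ET ^^ m"
    moreover have "ly u \<le> ly w + m" if "(u, w) \<in> ET ^^ m" for u w
      using that
    proof (induction m arbitrary: w)
      case (Suc m)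
      then obtain y where "(u, y) \<in> ET ^^ m" "(y, w) \<in> ET" by auto
      then show ?case using Suc.IH[of y] ET_ly(1)[of y w] by simp
    qed simp
    ultimately show "Suc k \<le> m" using ly_s lx by fastforce
  qed
  have "is_T (Suc k) V ET"
    unfolding is_T_def tree_def
    using finV simpleT connT acyclic val dist s_in by auto
  moreover have "E = join_twin_leaves V ET"
  proof -
    \<comment> \<open>The common parent is an image of \<open>b\<close>, so by
      \<open>N_b_Orb\<close> the two leaves are the images of \<open>v\<close> and
      \<open>a\<close>.\<close>
    have sib: "(x, y) \<in> E"
      if xO: "x \<in> Orb v" and that: "y \<in> Orb v" "x \<noteq> y" "(x, z) \<in> ET" "(y, z) \<in> ET" for x y z
    proof -
      obtain \<psi> where \<psi>: "\<psi> \<in> Aut V E" "x = \<psi> v" using Orb_obtain[OF xO] .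
      have V: "x \<in> V" "y \<in> V" using xO that(1) Orb_subset[OF v_in] by auto
      have "(x, z) \<in> up" using that(3) up_ly(2)[of z x] ly_0[OF V(1)] xO unfolding ET_iff by auto
      moreover have "(x, \<psi> b) \<in> up"
        using up_I[OF live_0, of x "\<psi> b"] xO Orb_I[OF \<psi>(1), of b] Aut_edge[OF \<psi>(1), of v b] v_edges \<psi>(2)
        by simp
      ultimately have z: "z = \<psi> b" using up_functional by blast
      have "(y, z) \<in> E" using ET_E that(4) by blast
      then have "y \<in> N (\<psi> b) \<inter> Orb v" using that(1) edge_sym[of y z] z by simp
      then have "y \<in> \<psi> ` {v, a}" unfolding Aut_neighbors_Orb[OF \<psi>(1)] N_b_Orb .
      then have "y = \<psi> a" using that(2) \<psi>(2) by auto
      then show ?thesis using Aut_edge[OF \<psi>(1), of v a] v_edges \<psi>(2) by simp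
    qed
    show ?thesis
    proof (intro equalityI subrelI)
      fix x y assume e: "(x, y) \<in> E"
      have "neighbors ET x \<inter> neighbors ET y \<noteq> {}" if "(x, z) \<in> up" "(y, z) \<in> up" for z
      proof -
        have "z \<in> neighbors ET x \<inter> neighbors ET y" using that ET_iff by simp
        then show ?thesis by blast
      qed
      then show "(x, y) \<in> join_twin_leaves V ET"
        using E_cases[OF e] edge_neq[OF e] unfolding join_twin_leaves_def leaves_eq by blast
    next
      fix x y assume "(x, y) \<in> join_twin_leaves V ET"
      then show "(x, y) \<in> E"
        unfolding join_twin_leaves_def leaves_eq using ET_E sib by auto
    qed
  qed
  ultimately show ?thesis unfolding is_S_def by blast
qed

section \<open>Combining the cases\<close>

lemma two_distinguishable_or_is_S:
  "two_distinguishable V E \<or> (\<exists>n\<ge>2. is_S n V E)"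
proof (cases "\<forall>k. live k \<longrightarrow> \<not> climbs k \<longrightarrow> chain (Suc k) \<in> Orb (chain k) \<or>
    N (chain (Suc k)) \<subseteq> Orb (chain k) \<and> card (N (chain (Suc k))) \<le> 2")
  case True
  then show ?thesis using two_distinguishable_closes by blast
next
  case False
  then obtain k where k: "live k" "\<not> climbs k" and s: "chain (Suc k) \<notin> Orb (chain k)"
    and nc: "\<not> (N (chain (Suc k)) \<subseteq> Orb (chain k) \<and> card (N (chain (Suc k))) \<le> 2)" by blast
  show ?thesis
  proof (cases "N (chain (Suc k)) \<subseteq> Orb (chain k)")
    case True
    have "card (N (chain (Suc k))) = 3"
      using nc True card_neighbors_le[OF chain_Suc_in[OF k(1)]] by linarith
    then have "is_S (Suc k) V E" using is_S_closes[OF k True] by blast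
    \<comment> \<open>The chain always climbs at index 0, whence the bound 2.\<close>
    moreover have "Suc k \<ge> 2" using not_climbs_pos[OF k(2)] by simp
    ultimately show ?thesis by blast
  next
    case False
    then show ?thesis using two_distinguishable_good_arc[OF k s] by blast
  qed
qed

end

text \<open>In the triangle case either \<open>a\<close> or \<open>b\<close> may be the twin of
  \<open>v\<close>, hence the second interpretation with their roles exchanged.\<close>

lemma (in type_one_vertex) two_distinguishable_or_is_S:
  "two_distinguishable V E \<or> (\<exists>n\<ge>2. is_S n V E)"
proof -
  consider "N a = {v, b}" | "N b = {v, a}" | x where "x \<noteq> v" "N x = N v"
    | "N a \<noteq> {v, b}" "N b \<noteq> {v, a}" "\<And>x. N x = N v \<Longrightarrow> x = v" by blast
  then show ?thesis
  proof cases
    case 1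
    then interpret triangle_vertex V E v a b by unfold_locales
    show ?thesis by (rule two_distinguishable_or_is_S)
  next
    case 2
    interpret sw: triangle_vertex V E v b a
      by unfold_locales (use 2 v_in N_v a_neq_b stab in auto)
    show ?thesis by (rule sw.two_distinguishable_or_is_S)
  next
    case 3
    then show ?thesis using two_distinguishable_square by blast
  next
    case 4
    then show ?thesis using two_distinguishable_generic by blast
  qed
qed

text \<open>The identity belongs to the stabilizer, so a single induced permutation must be its
  restriction.\<close>

lemma vertex_type_1_fixes_neighbors:
  assumes "vertex_type V E v = 1" "\<phi> \<in> Aut V E" "\<phi> v = v" "(v, x) \<in> E"
  shows "\<phi> x = x"
proof -
  let ?r = "\<lambda>\<phi> :: 'a \<Rightarrow> 'a. restrict \<phi> (neighbors E v)"
  have stab: "id \<in> Aut_stab V E v" "\<phi> \<in> Aut_stab V E v"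
    using assms(2,3) by (auto simp: Aut_stab_def Aut_def permutes_id)
  obtain g where g: "?r ` Aut_stab V E v = {g}"
    using assms(1) unfolding vertex_type_def by (auto simp: card_1_singleton_iff)
  have "?r \<psi> = g" if "\<psi> \<in> Aut_stab V E v" for \<psi>
    using imageI[OF that, of ?r] unfolding g by simp
  then have "?r \<phi> = ?r id" using stab by simp
  then have "?r \<phi> x = ?r id x" by simp
  then show ?thesis using assms(4) by simp
qed

section \<open>Isomorphic copies\<close>

text \<open>Moves a copy of \<open>S_n\<close> to natural numbers, since the existential claim of
  the theorem has to fix a vertex type.\<close>

locale graph_embedding =
  fixes V :: "'a set" and E :: "('a \<times> 'a) set" and f :: "'a \<Rightarrow> 'b"
  assumes E_sub: "E \<subseteq> V \<times> V" and inj: "inj_on f V"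
begin

abbreviation "E' \<equiv> map_prod f f ` E"

lemma edge_iff: "x \<in> V \<Longrightarrow> y \<in> V \<Longrightarrow> (f x, f y) \<in> E' \<longleftrightarrow> (x, y) \<in> E"
  using E_sub inj by (auto dest: inj_onD)

lemma edge_obtain:
  assumes "(u, w) \<in> E'"
  obtains x y where "x \<in> V" "y \<in> V" "u = f x" "w = f y" "(x, y) \<in> E"
  using assms E_sub by auto

lemma neighbors_image: "x \<in> V \<Longrightarrow> neighbors E' (f x) = f ` neighbors E x"
  using E_sub inj by (force simp: inj_on_eq_iff)

lemma valence_image:
  assumes "x \<in> V"
  shows "valence E' (f x) = valence E x"
proof -
  have "neighbors E x \<subseteq> V" using E_sub by auto
  then have "inj_on f (neighbors E x)" using inj inj_on_subset by blast
  then show ?thesis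
    unfolding valence_def neighbors_image[OF assms] by (simp add: card_image finite_image_iff)
qed

lemma leaves_image: "leaves (f ` V) E' = f ` leaves V E"
  unfolding leaves_def using valence_image by auto

lemma relpow_image: "(x, y) \<in> E ^^ n \<Longrightarrow> (f x, f y) \<in> E' ^^ n"
proof (induction n arbitrary: y)
  case (Suc n)
  then obtain z where "(x, z) \<in> E ^^ n" "(z, y) \<in> E" by auto
  then show ?case using Suc.IH by (intro relpow_Suc_I[of _ "f z"]) auto
qed simp

lemma relpow_image_obtain:
  assumes "(f x, w) \<in> E' ^^ n" "x \<in> V"
  shows "\<exists>y\<in>V. w = f y \<and> (x, y) \<in> E ^^ n"
  using assms(1)
proof (induction n arbitrary: w)
  case (Suc n)
  then obtain u where u: "(f x, u) \<in> E' ^^ n" "(u, w) \<in> E'" by auto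
  from Suc.IH[OF u(1)] obtain y where y: "y \<in> V" "u = f y" "(x, y) \<in> E ^^ n" by blast
  obtain y1 z where z: "y1 \<in> V" "z \<in> V" "u = f y1" "w = f z" "(y1, z) \<in> E"
    using edge_obtain[OF u(2)] .
  then have "y1 = y" using y inj by (simp add: inj_on_eq_iff)
  then show ?case using z y by auto
qed (use assms(2) in simp)

lemma relpow_iff: "x \<in> V \<Longrightarrow> y \<in> V \<Longrightarrow> (f x, f y) \<in> E' ^^ n \<longleftrightarrow> (x, y) \<in> E ^^ n"
  using relpow_image relpow_image_obtain inj by (metis inj_on_eq_iff)

lemma graph_dist_image: "x \<in> V \<Longrightarrow> y \<in> V \<Longrightarrow> graph_dist E' (f x) (f y) = graph_dist E x y"
  unfolding graph_dist_def by (simp add: relpow_iff)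

lemma graph_cycle_image:
  assumes "graph_cycle E' us"
  shows "\<exists>xs. graph_cycle E xs"
proof -
  let ?n = "length us" and ?g = "inv_into V f"
  have n: "?n \<ge> 3" "distinct us" and e: "\<And>i. i < ?n \<Longrightarrow> (us ! i, us ! (Suc i mod ?n)) \<in> E'"
    using assms unfolding graph_cycle_def by auto
  have us: "us ! i \<in> f ` V" if "i < ?n" for i
    using edge_obtain[OF e[OF that]] by blast
  have edge: "(?g u, ?g w) \<in> E" if uw: "(u, w) \<in> E'" for u w
  proof -
    obtain x y where "x \<in> V" "y \<in> V" "u = f x" "w = f y" "(x, y) \<in> E" using edge_obtain[OF uw] .
    then show ?thesis using inv_into_f_f[OF inj] by simp
  qed
  have "set us \<subseteq> f ` V" using us by (auto simp: in_set_conv_nth)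
  then have "inj_on ?g (set us)" by (rule inj_on_inv_into)
  moreover have "(map ?g us ! i, map ?g us ! (Suc i mod ?n)) \<in> E" if "i < ?n" for i
  proof -
    have "Suc i mod ?n < ?n" by (rule mod_less_divisor) (use that in linarith)
    then show ?thesis using edge[OF e[OF that]] that by simp
  qed
  ultimately have "graph_cycle E (map ?g us)"
    unfolding graph_cycle_def using n by (simp add: distinct_map)
  then show ?thesis by blast
qed

lemma is_T_image:
  assumes T: "is_T n V E"
  shows "is_T n (f ` V) E'"
proof -
  from T have fin: "finite V" and tr: "tree V E"
    and val: "\<forall>x\<in>V. valence E x = 1 \<or> valence E x = 3"
    and "\<exists>r\<in>V. \<forall>x\<in>leaves V E. graph_dist E r x = n" by (simp_all add: is_T_def)
  then obtain r where r: "r \<in> V" "\<forall>x\<in>leaves V E. graph_dist E r x = n" by blast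
  have s: "simple_graph V E" and c: "connected_graph V E" and ac: "\<not> (\<exists>xs. graph_cycle E xs)"
    using tr by (simp_all add: tree_def)
  have s': "simple_graph (f ` V) E'"
    unfolding simple_graph_def
  proof (intro conjI)
    show "E' \<subseteq> f ` V \<times> f ` V" using E_sub by auto
    have "sym E" "irrefl E" using s by (simp_all add: simple_graph_def)
    show "sym E'"
      using \<open>sym E\<close> by (auto intro!: symI dest: symD)
    show "irrefl E'"
    proof (rule irreflI)
      fix u show "(u, u) \<notin> E'"
      proof
        assume "(u, u) \<in> E'"
        then obtain x y where "x \<in> V" "y \<in> V" "u = f x" "u = f y" "(x, y) \<in> E"
          using edge_obtain by metis
        then show False using inj \<open>irrefl E\<close> by (metis inj_onD irreflD)
      qed
    qed
  qed
  have c': "connected_graph (f ` V) E'"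
    unfolding connected_graph_def
  proof (intro conjI ballI)
    show "f ` V \<noteq> {}" using c by (simp add: connected_graph_def)
    fix u w assume "u \<in> f ` V" "w \<in> f ` V"
    then obtain x y where xy: "x \<in> V" "y \<in> V" "u = f x" "w = f y" by blast
    then have "(x, y) \<in> E\<^sup>*" using c by (simp add: connected_graph_def)
    then obtain m where "(x, y) \<in> E ^^ m" using rtrancl_imp_relpow by blast
    then show "(u, w) \<in> E'\<^sup>*" using relpow_image xy relpow_imp_rtrancl by blast
  qed
  have "\<forall>x\<in>leaves (f ` V) E'. graph_dist E' (f r) x = n"
    unfolding leaves_image using r graph_dist_image by (auto simp: leaves_def)
  moreover have "\<forall>x\<in>f ` V. valence E' x = 1 \<or> valence E' x = 3"
    using val valence_image by auto
  moreover have "tree (f ` V) E'" using s' c' ac graph_cycle_image by (auto simp: tree_def)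
  ultimately show ?thesis unfolding is_T_def using fin r(1) by blast
qed

end

lemma join_twin_leaves_image:
  assumes "E \<subseteq> V \<times> V" "inj_on f V"
  shows "join_twin_leaves (f ` V) (map_prod f f ` E) = map_prod f f ` join_twin_leaves V E"
proof -
  interpret graph_embedding V E f by unfold_locales (use assms in auto)
  have L: "leaves V E \<subseteq> V" by (auto simp: leaves_def)
  have disj: "neighbors E' (f x) \<inter> neighbors E' (f y) \<noteq> {} \<longleftrightarrow> neighbors E x \<inter> neighbors E y \<noteq> {}"
    if "x \<in> V" "y \<in> V" for x y
  proof -
    have "neighbors E x \<subseteq> V" "neighbors E y \<subseteq> V" using E_sub by auto
    then show ?thesis
      using inj_on_image_Int[OF inj, of "neighbors E x" "neighbors E y"]
      unfolding neighbors_image[OF that(1)] neighbors_image[OF that(2)] by blast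
  qed
  let ?J = "{(x, y). x \<in> leaves V E \<and> y \<in> leaves V E \<and> x \<noteq> y \<and> neighbors E x \<inter> neighbors E y \<noteq> {}}"
  let ?J' = "{(x, y). x \<in> leaves (f ` V) E' \<and> y \<in> leaves (f ` V) E' \<and> x \<noteq> y \<and>
    neighbors E' x \<inter> neighbors E' y \<noteq> {}}"
  have "?J' = map_prod f f ` ?J"
  proof (intro equalityI subsetI)
    fix p assume "p \<in> ?J'"
    then obtain x y where xy: "p = (f x, f y)" "x \<in> leaves V E" "y \<in> leaves V E" "f x \<noteq> f y"
      "neighbors E' (f x) \<inter> neighbors E' (f y) \<noteq> {}" unfolding leaves_image by blast
    then have "(x, y) \<in> ?J" using disj[of x y] L by auto
    then show "p \<in> map_prod f f ` ?J" using xy(1) by (auto intro: rev_image_eqI)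
  next
    fix p assume "p \<in> map_prod f f ` ?J"
    then obtain x y where xy: "p = (f x, f y)" "x \<in> leaves V E" "y \<in> leaves V E" "x \<noteq> y"
      "neighbors E x \<inter> neighbors E y \<noteq> {}" by auto
    then have "f x \<noteq> f y" using L inj by (metis inj_onD subsetD)
    moreover have "neighbors E' (f x) \<inter> neighbors E' (f y) \<noteq> {}" using disj[of x y] xy L by blast
    ultimately show "p \<in> ?J'" using xy unfolding leaves_image by blast
  qed
  then show ?thesis unfolding join_twin_leaves_def image_Un by simp
qed

text \<open>The vertex set is finite, so it can be numbered; one numbering serves the tree and the
  graph built from it.\<close>

lemma is_S_imp_nat_copy:
  assumes "is_S n V E"
  shows "\<exists>(V' :: nat set) E'. is_S n V' E' \<and> graph_iso V E V' E'"
proof -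
  obtain ET where T: "is_T n V ET" and J: "E = join_twin_leaves V ET"
    using assms unfolding is_S_def by blast
  have fin: "finite V" and sub: "ET \<subseteq> V \<times> V"
    using T by (auto simp: is_T_def tree_def simple_graph_def)
  obtain f :: "'a \<Rightarrow> nat" where f: "inj_on f V" using finite_imp_inj_to_nat_seg[OF fin] by blast
  interpret T: graph_embedding V ET f by unfold_locales (use f sub in auto)
  have "E \<subseteq> V \<times> V" using J sub by (auto simp: join_twin_leaves_def leaves_def)
  then interpret G: graph_embedding V E f by unfold_locales (use f in auto)
  have "is_S n (f ` V) (map_prod f f ` E)"
    unfolding is_S_def using T.is_T_image[OF T] join_twin_leaves_image[OF sub f] J by blast
  moreover have "graph_iso V E (f ` V) (map_prod f f ` E)"
    unfolding graph_iso_def using f G.edge_iff by (intro exI[of _ f]) (simp add: inj_on_imp_bij_betw)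
  ultimately show ?thesis by blast
qed

theorem theorem5p1:
  fixes V :: "'a set" and E :: "('a \<times> 'a) set" and v :: 'a
  assumes "simple_graph V E"
    and "connected_graph V E"
    and "max_valence V E = 3"
    and "v \<in> V"
    and "valence E v = 2"
    and "vertex_type V E v = 1"
  shows "distinguishing_number V E \<le> 2 \<or>
    (\<exists>n\<ge>2. \<exists>(V' :: nat set) E'. is_S n V' E' \<and> graph_iso V E V' E')"
proof -
  \<comment> \<open>A finite bound in \<open>enat\<close> also excludes infinite
    neighbourhoods.\<close>
  have val: "finite (neighbors E x) \<and> card (neighbors E x) \<le> 3" if "x \<in> V" for x
  proof -
    have "valence E x \<le> 3"
      using SUP_upper[OF that, of "valence E"] assms(3) by (simp add: max_valence_def)
    then show ?thesis by (auto simp: valence_def numeral_eq_enat split: if_splits)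
  qed
  have "card (neighbors E v) = 2"
    using assms(5) by (auto simp: valence_def numeral_eq_enat split: if_splits)
  then obtain a b where ab: "neighbors E v = {a, b}" "a \<noteq> b" by (auto simp: card_2_iff)
  then have edges: "(v, a) \<in> E" "(v, b) \<in> E" by (auto simp: neighbors_def)
  interpret type_one_vertex V E v a b
    by unfold_locales
      (use assms val ab edges vertex_type_1_fixes_neighbors[OF assms(6)] in auto)
  show ?thesis
    using two_distinguishable_or_is_S distinguishing_number_le_2 is_S_imp_nat_copy by blast
qed

end
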